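(* Let WSP with UI and CI constraints be the following decision problem. The input is a workflow $W=(S,U,\mathcal{A},C)$ with $k=|S|$ steps and $n=|U|\ge k$ users, together with an equivalence relation $\sim$ on $U$, where $C=C_{=}\cup C_{\sim}$, every constraint in $C_{=}$ is user-independent and every constraint in $C_{\sim}$ is class-independent for $\sim$ (the authorization lists $\mathcal{A}$ are arbitrary). The question is whether $W$ has a valid plan. Assume that all constraints can be checked in time polynomial in $n$. Then this problem can be solved in $O^*(2^{k\log(3k)})$ time.
   Context: A workflow is $W=(S,U,\mathcal{A},C)$, where $S=\{s_1,\dots,s_k\}$ is a set of steps, $U=\{u_1,\dots,u_n\}$ is a set of users, $k\le n$, $\mathcal{A}=\{A(u):u\in U\}$ with $A(u)\subseteq S$ (the authorization list of $u$), and $C$ is a set of constraints. A constraint is a pair $c=(T,\Theta)$ with scope $T\subseteq S$ and $\Theta$ a set of functions $T\to U$ (given implicitly, not by enumeration). It is a standing assumption that whether a plan satisfies a constraint can be checked in time polynomial in $n$. A plan is a function $\pi:S\to U$. It is authorized if $s\in A(\pi(s))$ for all $s\in S$; it is eligible if $\pi|_T\in\Theta$ for all $(T,\Theta)\in C$; it is valid if it is both authorized and eligible. For an equivalence relation $\sim$ on $U$, $U^{\sim}$ is the set of equivalence classes and $u^{\sim}$ is the class of $u$. For a function $\theta$ with values in $U$, $\theta^{\sim}(s)=(\theta(s))^{\sim}$, and $\Theta^{\sim}=\{\theta^{\sim}:\theta\in\Theta\}$. A constraint $(T,\Theta)$ is class-independent (CI) for $\sim$ if (1) for every $\theta:T\to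 U$, $\theta^{\sim}\in\Theta^{\sim}$ implies $\theta\in\Theta$, and (2) for every permutation $\phi:U^{\sim}\to U^{\sim}$, $\theta^{\sim}\in\Theta^{\sim}$ implies $\phi\circ\theta^{\sim}\in\Theta^{\sim}$. A constraint is user-independent (UI) if it is CI for the equality relation $=$. $O^*(\cdot)$ suppresses factors polynomial in the input size. Logarithms are base 2. *)

theory Defs
  imports
    Complex_Main
    "HOL-Library.FuncSet"
    "HOL-Computational_Algebra.Polynomial"
begin

section \<open>Workflows and constraints\<close>

text \<open>
  Functions from a set \<open>T\<close> to a set \<open>U\<close> are the elements of \<open>T \<rightarrow>\<^sub>E U\<close>; in particular
  \<open>\<pi>|\<^sub>T\<close> is \<open>restrict \<pi> T\<close>.
\<close>

type_synonym ('s, 'u) wconstraint = "'s set \<times> ('s \<Rightarrow> 'u) set"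

record ('s, 'u) workflow =
  steps :: "'s set"
  users :: "'u set"
  auth :: "'u \<Rightarrow> 's set"
  constraints :: "('s, 'u) wconstraint set"

definition wf_constraint :: "'s set \<Rightarrow> 'u set \<Rightarrow> ('s, 'u) wconstraint \<Rightarrow> bool" where
  "wf_constraint S U c \<longleftrightarrow> (case c of (T, \<Theta>) \<Rightarrow> T \<subseteq> S \<and> \<Theta> \<subseteq> T \<rightarrow>\<^sub>E U)"

definition wf_workflow :: "('s, 'u) workflow \<Rightarrow> bool" where
  "wf_workflow W \<longleftrightarrow>
     finite (steps W) \<and> finite (users W) \<and> card (steps W) \<le> card (users W) \<and>
     (\<forall>u\<in>users W. auth W u \<subseteq> steps W) \<and>
     (\<forall>c\<in>constraints W. wf_constraint (steps W) (users W) c)"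

definition plans :: "('s, 'u) workflow \<Rightarrow> ('s \<Rightarrow> 'u) set" where
  "plans W = steps W \<rightarrow>\<^sub>E users W"

definition authorized :: "('s, 'u) workflow \<Rightarrow> ('s \<Rightarrow> 'u) \<Rightarrow> bool" where
  "authorized W \<pi> \<longleftrightarrow> (\<forall>s\<in>steps W. s \<in> auth W (\<pi> s))"

definition satisfies :: "('s \<Rightarrow> 'u) \<Rightarrow> ('s, 'u) wconstraint \<Rightarrow> bool" where
  "satisfies \<pi> c \<longleftrightarrow> (case c of (T, \<Theta>) \<Rightarrow> restrict \<pi> T \<in> \<Theta>)"

definition eligible :: "('s, 'u) workflow \<Rightarrow> ('s \<Rightarrow> 'u) \<Rightarrow> bool" where
  "eligible W \<pi> \<longleftrightarrow> (\<forall>c\<in>constraints W. satisfies \<pi> c)"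

definition valid_plan :: "('s, 'u) workflow \<Rightarrow> ('s \<Rightarrow> 'u) \<Rightarrow> bool" where
  "valid_plan W \<pi> \<longleftrightarrow> \<pi> \<in> plans W \<and> authorized W \<pi> \<and> eligible W \<pi>"

text \<open>
  \<open>class_fun r T \<theta>\<close> is \<open>\<theta>\<^sup>\<sim>\<close>, where \<open>r\<close> is the equivalence relation \<open>\<sim>\<close>; the class of \<open>u\<close> is
  \<open>r `` {u}\<close> and the set of classes is \<open>U // r\<close>.
\<close>

definition class_fun :: "('u \<times> 'u) set \<Rightarrow> 's set \<Rightarrow> ('s \<Rightarrow> 'u) \<Rightarrow> 's \<Rightarrow> 'u set" where
  "class_fun r T \<theta> = (\<lambda>s\<in>T. r `` {\<theta> s})"

definition class_independent ::
    "'u set \<Rightarrow> ('u \<times> 'u) set \<Rightarrow> ('s, 'u) wconstraint \<Rightarrow> bool" where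
  "class_independent U r c \<longleftrightarrow> (case c of (T, \<Theta>) \<Rightarrow>
     (\<forall>\<theta> \<in> T \<rightarrow>\<^sub>E U. class_fun r T \<theta> \<in> class_fun r T ` \<Theta> \<longrightarrow> \<theta> \<in> \<Theta>) \<and>
     (\<forall>\<phi>. bij_betw \<phi> (U // r) (U // r) \<longrightarrow>
        (\<forall>\<theta> \<in> T \<rightarrow>\<^sub>E U. class_fun r T \<theta> \<in> class_fun r T ` \<Theta> \<longrightarrow>
           compose T \<phi> (class_fun r T \<theta>) \<in> class_fun r T ` \<Theta>)))"

definition user_independent :: "'u set \<Rightarrow> ('s, 'u) wconstraint \<Rightarrow> bool" where
  "user_independent U c \<longleftrightarrow> class_independent U (Id_on U) c"


section \<open>Model of computation\<close>

text \<open>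
  Running times refer to Jones' WHILE language (N. D. Jones, Computability and Complexity from a
  Programming Perspective, MIT Press, 1997) over binary trees, i.e. LISP cells with a single atom.
  Every operation is charged one unit. Trees are immutable, so a random access machine executes
  each operation with a constant number of pointer operations, and no arithmetic on large numbers
  is available at unit cost. Conversely, a random access machine is simulated by keeping its
  memory in a search tree, with an overhead polylogarithmic in the running time if operands have
  logarithmic length. For running times of the form \<open>2 powr (k * log 2 (3 * k))\<close> times a polynomial,
  this is a factor polynomial in the input size, which \<open>O\<^sup>*\<close> suppresses.
\<close>

datatype tree = Leaf | Node tree tree

datatype expr = Var nat | LeafE | NodeE expr expr | Hd expr | Tl expr

datatype com = Skip | Assign nat expr | Seq com com | Cond expr com com | While expr com

type_synonym state = "nat \<Rightarrow> tree"

fun hd_tree :: "tree \<Rightarrow> tree" where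
  "hd_tree Leaf = Leaf"
| "hd_tree (Node l r) = l"

fun tl_tree :: "tree \<Rightarrow> tree" where
  "tl_tree Leaf = Leaf"
| "tl_tree (Node l r) = r"

fun expr_val :: "expr \<Rightarrow> state \<Rightarrow> tree" where
  "expr_val (Var x) s = s x"
| "expr_val LeafE s = Leaf"
| "expr_val (NodeE e f) s = Node (expr_val e s) (expr_val f s)"
| "expr_val (Hd e) s = hd_tree (expr_val e s)"
| "expr_val (Tl e) s = tl_tree (expr_val e s)"

fun expr_time :: "expr \<Rightarrow> nat" where
  "expr_time (Var x) = 1"
| "expr_time LeafE = 1"
| "expr_time (NodeE e f) = 1 + expr_time e + expr_time f"
| "expr_time (Hd e) = 1 + expr_time e"
| "expr_time (Tl e) = 1 + expr_time e"

text \<open>\<open>exec c s t s'\<close>: started in \<open>s\<close>, the command \<open>c\<close> halts after time \<open>t\<close> in \<open>s'\<close>.\<close>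

inductive exec :: "com \<Rightarrow> state \<Rightarrow> nat \<Rightarrow> state \<Rightarrow> bool" where
  Skip: "exec Skip s 1 s"
| Assign: "exec (Assign x e) s (1 + expr_time e) (s(x := expr_val e s))"
| Seq: "exec c s t s' \<Longrightarrow> exec d s' t' s'' \<Longrightarrow> exec (Seq c d) s (1 + t + t') s''"
| CondTrue: "expr_val e s \<noteq> Leaf \<Longrightarrow> exec c s t s' \<Longrightarrow>
    exec (Cond e c d) s (1 + expr_time e + t) s'"
| CondFalse: "expr_val e s = Leaf \<Longrightarrow> exec d s t s' \<Longrightarrow>
    exec (Cond e c d) s (1 + expr_time e + t) s'"
| WhileFalse: "expr_val e s = Leaf \<Longrightarrow> exec (While e c) s (1 + expr_time e) s"
| WhileTrue: "expr_val e s \<noteq> Leaf \<Longrightarrow> exec c s t s' \<Longrightarrow> exec (While e c) s' t' s'' \<Longrightarrow>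
    exec (While e c) s (1 + expr_time e + t + t') s''"

lemma exec_deterministic:
  "exec c s t s' \<Longrightarrow> exec c s u s'' \<Longrightarrow> t = u \<and> s' = s''"
proof (induction arbitrary: u s'' rule: exec.induct)
  case (Skip s)
  then show ?case by (auto elim: exec.cases)
next
  case (Assign x e s)
  then show ?case by (auto elim: exec.cases)
next
  case (Seq c s t s' d t' s2)
  from Seq.prems show ?case
    by (cases rule: exec.cases) (use Seq.IH in blast)+
next
  case (CondTrue e s c t s' d)
  from CondTrue.prems show ?case
    by (cases rule: exec.cases) (use CondTrue in blast)+
next
  case (CondFalse e s d t s' c)
  from CondFalse.prems show ?case
    by (cases rule: exec.cases) (use CondFalse in blast)+
next
  case (WhileFalse e s c)
  from WhileFalse.prems show ?case
    by (cases rule: exec.cases) (use WhileFalse in auto)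
next
  case (WhileTrue e s c t s' t' s2)
  from WhileTrue.prems show ?case
    by (cases rule: exec.cases) (use WhileTrue in blast)+
qed

text \<open>
  The input is passed in variable \<open>0\<close>, all other variables initially hold \<open>Leaf\<close>; the answer is
  read off variable \<open>0\<close>, where \<open>Leaf\<close> means no and any other tree means yes.
\<close>

definition decides_within :: "com \<Rightarrow> tree \<Rightarrow> bool \<Rightarrow> real \<Rightarrow> bool" where
  "decides_within P x answer b \<longleftrightarrow>
     (\<exists>t s. exec P ((\<lambda>_. Leaf)(0 := x)) t s \<and> real t \<le> b \<and> (s 0 \<noteq> Leaf \<longleftrightarrow> answer))"


section \<open>Problem instances and their encoding\<close>

text \<open>
  Numbers are encoded in unary. Since the input lists all steps and users, this changes its
  size only polynomially.
\<close>

fun enc_list :: "tree list \<Rightarrow> tree" where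
  "enc_list [] = Leaf"
| "enc_list (x # xs) = Node x (enc_list xs)"

definition enc_nat :: "nat \<Rightarrow> tree" where
  "enc_nat n = enc_list (replicate n Leaf)"

definition enc_rel :: "nat \<Rightarrow> (nat \<times> nat) set \<Rightarrow> tree" where
  "enc_rel n r =
     enc_list (map (\<lambda>u. enc_list (map enc_nat (filter (\<lambda>v. (u, v) \<in> r) [0..<n]))) [0..<n])"

definition enc_auth :: "nat \<Rightarrow> nat \<Rightarrow> (nat \<Rightarrow> nat set) \<Rightarrow> tree" where
  "enc_auth k n A =
     enc_list (map (\<lambda>u. enc_list (map enc_nat (filter (\<lambda>s. s \<in> A u) [0..<k]))) [0..<n])"

definition enc_plan :: "nat \<Rightarrow> (nat \<Rightarrow> nat) \<Rightarrow> tree" where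
  "enc_plan k \<pi> = enc_list (map (\<lambda>s. enc_nat (\<pi> s)) [0..<k])"

text \<open>
  The steps are \<open>0, \<dots>, k - 1\<close> and the users \<open>0, \<dots>, n - 1\<close>. Constraints are given implicitly:
  the input contains a description of each constraint, and a constraint language assigns to
  \<open>k\<close>, \<open>n\<close>, \<open>\<sim>\<close> and a description the constraint that it stands for. The descriptions and their
  meaning are arbitrary, subject only to \<open>poly_time_checkable\<close> below.
\<close>

type_synonym constraint_language =
  "nat \<Rightarrow> nat \<Rightarrow> (nat \<times> nat) set \<Rightarrow> tree \<Rightarrow> (nat, nat) wconstraint"

record wsp_instance =
  num_steps :: nat
  num_users :: nat
  auths :: "nat \<Rightarrow> nat set"
  user_equiv :: "(nat \<times> nat) set"
  descriptions :: "tree list"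

definition constraint_of :: "constraint_language \<Rightarrow> wsp_instance \<Rightarrow> tree \<Rightarrow> (nat, nat) wconstraint"
  where
  "constraint_of L I d = L (num_steps I) (num_users I) (user_equiv I) d"

definition workflow_of :: "constraint_language \<Rightarrow> wsp_instance \<Rightarrow> (nat, nat) workflow" where
  "workflow_of L I =
     \<lparr> steps = {..<num_steps I}, users = {..<num_users I}, auth = auths I,
       constraints = constraint_of L I ` set (descriptions I) \<rparr>"

definition ui_ci_instance :: "constraint_language \<Rightarrow> wsp_instance \<Rightarrow> bool" where
  "ui_ci_instance L I \<longleftrightarrow>
     (let W = workflow_of L I; U = users W; r = user_equiv I in
        wf_workflow W \<and> equiv U r \<and>
        (\<exists>C_eq C_cls. constraints W = C_eq \<union> C_cls \<and>
           (\<forall>c\<in>C_eq. user_independent U c) \<and> (\<forall>c\<in>C_cls. class_independent U r c)))"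

definition enc_instance :: "wsp_instance \<Rightarrow> tree" where
  "enc_instance I = enc_list
     [enc_nat (num_steps I), enc_nat (num_users I),
      enc_auth (num_steps I) (num_users I) (auths I),
      enc_rel (num_users I) (user_equiv I),
      enc_list (descriptions I)]"

definition enc_query :: "wsp_instance \<Rightarrow> tree \<Rightarrow> (nat \<Rightarrow> nat) \<Rightarrow> tree" where
  "enc_query I d \<pi> = enc_list
     [enc_nat (num_steps I), enc_nat (num_users I), enc_rel (num_users I) (user_equiv I),
      d, enc_plan (num_steps I) \<pi>]"

text \<open>
  One program decides, in time polynomial in the number of users, whether a plan satisfies a
  constraint. It is only required to work on constraints that occur in instances of the problem.
\<close>

definition poly_time_checkable :: "constraint_language \<Rightarrow> bool" where
  "poly_time_checkable L \<longleftrightarrow>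
     (\<exists>(P :: com) (q :: nat poly). \<forall>I d \<pi>.
        ui_ci_instance L I \<longrightarrow> d \<in> set (descriptions I) \<longrightarrow> \<pi> \<in> plans (workflow_of L I) \<longrightarrow>
        decides_within P (enc_query I d \<pi>) (satisfies \<pi> (constraint_of L I d))
          (real (poly q (num_users I))))"

text \<open>
  \<open>size\<close> counts the cells of a tree. The polynomial \<open>p\<close> is the factor suppressed by \<open>O\<^sup>*\<close>; it
  and the program must be the same for all instances.
\<close>

definition ui_ci_wsp_solvable_in_O_star :: "constraint_language \<Rightarrow> (nat \<Rightarrow> real) \<Rightarrow> bool" where
  "ui_ci_wsp_solvable_in_O_star L f \<longleftrightarrow>
     (\<exists>(P :: com) (p :: nat poly). \<forall>I. ui_ci_instance L I \<longrightarrow>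
        decides_within P (enc_instance I) (\<exists>\<pi>. valid_plan (workflow_of L I) \<pi>)
          (real (poly p (size (enc_instance I))) * f (num_steps I)))"

end

(*
  Eligibility of a plan depends only on which steps share a user and which steps share a class of
  users: two plans that agree on both partitions satisfy the same user-independent and
  class-independent constraints. A pair of such partitions is described by k digits below 2k, so
  there are at most (2k)^k <= (3k)^k of them. For each pair, an authorized plan inducing it is found
  in polynomial time, if there is one, by two levels of bipartite matching: for each class C and each
  set of steps that is to share a class, match the groups of steps inside it to users of C; then
  match these sets to the classes for which this succeeded. It remains to check the constraints on
  one plan per pair.

  On the machine this is a single loop over all digit vectors whose body runs in polynomial time.
*)
theory Submission
  imports Defs
begin

section \<open>Subroutine calls and control structures\<close>

text \<open>Describing the two partitions independently would take k^(2k) vectors. One digit per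
  step suffices because the class of a group of steps sharing a user has to be recorded only at the
  representative of the group: the digit of a representative names a class, which takes k values,
  and any other digit points to a representative, which takes k more. Vectors that describe no pair
  of partitions do no harm, since every candidate is verified.

  The obstacle is the machine. Programs are timed by hand only for a few combinators; beyond these,
  a predicate \<open>pt D f\<close>, closed under composition, branching and folds with bounded
  accumulators, carries polynomial time from HOL functions to programs. The domain \<open>D\<close>
  is essential: the constraint checker promises nothing outside genuine queries, so its calls have
  to be confined to them. The outer loop makes exponentially many passes and lies outside
  \<open>pt\<close>; what enters for it is the cost of one pass and a bound on the size of its
  states.\<close>

fun rename_expr :: "nat \<Rightarrow> expr \<Rightarrow> expr" where
  "rename_expr j (Var x) = Var (x + j)"
| "rename_expr j LeafE = LeafE"
| "rename_expr j (NodeE e f) = NodeE (rename_expr j e) (rename_expr j f)"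
| "rename_expr j (Hd e) = Hd (rename_expr j e)"
| "rename_expr j (Tl e) = Tl (rename_expr j e)"

fun rename_com :: "nat \<Rightarrow> com \<Rightarrow> com" where
  "rename_com j Skip = Skip"
| "rename_com j (Assign x e) = Assign (x + j) (rename_expr j e)"
| "rename_com j (Seq c d) = Seq (rename_com j c) (rename_com j d)"
| "rename_com j (Cond e c d) = Cond (rename_expr j e) (rename_com j c) (rename_com j d)"
| "rename_com j (While e c) = While (rename_expr j e) (rename_com j c)"

fun expr_bound :: "expr \<Rightarrow> nat" where
  "expr_bound (Var x) = Suc x"
| "expr_bound LeafE = 0"
| "expr_bound (NodeE e f) = max (expr_bound e) (expr_bound f)"
| "expr_bound (Hd e) = expr_bound e"
| "expr_bound (Tl e) = expr_bound e"

text \<open>A strict bound on the registers that a command can read or write. It delimits the block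
  occupied by a shifted copy and the number of resets paid for by a call.\<close>

fun com_bound :: "com \<Rightarrow> nat" where
  "com_bound Skip = 0"
| "com_bound (Assign x e) = max (Suc x) (expr_bound e)"
| "com_bound (Seq c d) = max (com_bound c) (com_bound d)"
| "com_bound (Cond e c d) = max (expr_bound e) (max (com_bound c) (com_bound d))"
| "com_bound (While e c) = max (expr_bound e) (com_bound c)"

lemma expr_val_rename:
  "expr_bound e \<le> m \<Longrightarrow> \<forall>i<m. \<sigma> (i + j) = s i \<Longrightarrow> expr_val (rename_expr j e) \<sigma> = expr_val e s"
  by (induction e) auto

lemma expr_time_rename [simp]: "expr_time (rename_expr j e) = expr_time e"
  by (induction e) auto

text \<open>Induction on the execution, with the block of \<open>m\<close> registers from
  \<open>j\<close> on mirroring the original state. Every register that \<open>c\<close> touches is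
  mirrored, so the correspondence survives each step; the registers below \<open>j\<close> are where
  a caller keeps its data.\<close>

lemma exec_rename:
  assumes "exec c s t s'" "com_bound c \<le> m" "\<forall>i<m. \<sigma> (i + j) = s i"
  shows "\<exists>\<sigma>'. exec (rename_com j c) \<sigma> t \<sigma>' \<and> (\<forall>i<m. \<sigma>' (i + j) = s' i) \<and> (\<forall>i<j. \<sigma>' i = \<sigma> i)"
  using assms
proof (induction arbitrary: \<sigma> rule: exec.induct)
  case (Skip s)
  then show ?case using exec.Skip[of \<sigma>] by (intro exI[of _ \<sigma>]) auto
next
  case (Assign x e s)
  have "exec (rename_com j (Assign x e)) \<sigma> (1 + expr_time e)
      (\<sigma>(x + j := expr_val (rename_expr j e) \<sigma>))"
    using exec.Assign[of "x + j" "rename_expr j e" \<sigma>] by simp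
  then have "exec (rename_com j (Assign x e)) \<sigma> (1 + expr_time e) (\<sigma>(x + j := expr_val e s))"
    using Assign by (subst (asm) expr_val_rename[where m = m and s = s]) auto
  moreover have "\<forall>i<m. (\<sigma>(x + j := expr_val e s)) (i + j) = (s(x := expr_val e s)) i"
    "\<forall>i<j. (\<sigma>(x + j := expr_val e s)) i = \<sigma> i"
    using Assign by auto
  ultimately show ?case by blast
next
  case (Seq c s t s' d t' s'')
  obtain \<sigma>1 where 1: "exec (rename_com j c) \<sigma> t \<sigma>1" "\<forall>i<m. \<sigma>1 (i + j) = s' i" "\<forall>i<j. \<sigma>1 i = \<sigma> i"
    using Seq.IH(1)[of \<sigma>] Seq.prems by auto
  obtain \<sigma>2 where 2: "exec (rename_com j d) \<sigma>1 t' \<sigma>2" "\<forall>i<m. \<sigma>2 (i + j) = s'' i" "\<forall>i<j. \<sigma>2 i = \<sigma>1 i"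
    using Seq.IH(2)[of \<sigma>1] Seq.prems 1(2) by auto
  have "\<forall>i<j. \<sigma>2 i = \<sigma> i" using 1(3) 2(3) by simp
  with exec.Seq[OF 1(1) 2(1)] 2(2) show ?case unfolding rename_com.simps by blast
next
  case (CondTrue e s c t s' d)
  have "expr_val (rename_expr j e) \<sigma> \<noteq> Leaf"
    using CondTrue by (subst expr_val_rename[where m = m and s = s]) auto
  moreover obtain \<sigma>1 where
    "exec (rename_com j c) \<sigma> t \<sigma>1" "\<forall>i<m. \<sigma>1 (i + j) = s' i" "\<forall>i<j. \<sigma>1 i = \<sigma> i"
    using CondTrue.IH[of \<sigma>] CondTrue.prems by auto
  ultimately show ?case
    using exec.CondTrue[of "rename_expr j e" \<sigma> "rename_com j c" t \<sigma>1]
    unfolding rename_com.simps expr_time_rename by blast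
next
  case (CondFalse e s d t s' c)
  have "expr_val (rename_expr j e) \<sigma> = Leaf"
    using CondFalse by (subst expr_val_rename[where m = m and s = s]) auto
  moreover obtain \<sigma>1 where
    "exec (rename_com j d) \<sigma> t \<sigma>1" "\<forall>i<m. \<sigma>1 (i + j) = s' i" "\<forall>i<j. \<sigma>1 i = \<sigma> i"
    using CondFalse.IH[of \<sigma>] CondFalse.prems by auto
  ultimately show ?case
    using exec.CondFalse[of "rename_expr j e" \<sigma> "rename_com j d" t \<sigma>1]
    unfolding rename_com.simps expr_time_rename by blast
next
  case (WhileFalse e s c)
  have "expr_val (rename_expr j e) \<sigma> = Leaf"
    using WhileFalse by (subst expr_val_rename[where m = m and s = s]) auto
  then show ?case
    using exec.WhileFalse[of "rename_expr j e" \<sigma> "rename_com j c"] WhileFalse.prems(2)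
    unfolding rename_com.simps expr_time_rename by blast
next
  case (WhileTrue e s c t s' t' s'')
  have v: "expr_val (rename_expr j e) \<sigma> \<noteq> Leaf"
    using WhileTrue by (subst expr_val_rename[where m = m and s = s]) auto
  obtain \<sigma>1 where
    1: "exec (rename_com j c) \<sigma> t \<sigma>1" "\<forall>i<m. \<sigma>1 (i + j) = s' i" "\<forall>i<j. \<sigma>1 i = \<sigma> i"
    using WhileTrue.IH(1)[of \<sigma>] WhileTrue.prems by auto
  obtain \<sigma>2 where
    2: "exec (rename_com j (While e c)) \<sigma>1 t' \<sigma>2" "\<forall>i<m. \<sigma>2 (i + j) = s'' i" "\<forall>i<j. \<sigma>2 i = \<sigma>1 i"
    using WhileTrue.IH(2)[of \<sigma>1] WhileTrue.prems 1(2) by blast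
  have "\<forall>i<j. \<sigma>2 i = \<sigma> i" using 1(3) 2(3) by simp
  with exec.WhileTrue[OF v 1(1) 2(1)[unfolded rename_com.simps]] 2(2) show ?case
    unfolding rename_com.simps expr_time_rename by blast
qed

lemma exec_AssignI:
  "t = 1 + expr_time e \<Longrightarrow> s' = s(x := expr_val e s) \<Longrightarrow> exec (Assign x e) s t s'"
  using exec.Assign by simp

lemma exec_SeqI:
  "exec c s t s' \<Longrightarrow> exec d s' t' s'' \<Longrightarrow> u = 1 + t + t' \<Longrightarrow> exec (Seq c d) s u s''"
  using exec.Seq by simp

text \<open>\<open>T\<close> is only an upper bound, so estimates can be coarsened freely. The final
  contents of the other registers are left open, hence a later call has to reset them.\<close>

definition computes_in :: "com \<Rightarrow> tree \<Rightarrow> nat \<Rightarrow> tree \<Rightarrow> bool" where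
  "computes_in P x T y \<longleftrightarrow> (\<exists>t s. exec P ((\<lambda>_. Leaf)(0 := x)) t s \<and> t \<le> T \<and> s 0 = y)"

lemma computes_in_mono: "computes_in P x T y \<Longrightarrow> T \<le> T' \<Longrightarrow> computes_in P x T' y"
  unfolding computes_in_def using le_trans by blast

fun clear :: "nat \<Rightarrow> nat \<Rightarrow> com" where
  "clear j 0 = Skip"
| "clear j (Suc n) = Seq (clear j n) (Assign (j + n) LeafE)"

lemma exec_clear:
  "\<exists>s'. exec (clear j n) s (1 + 3 * n) s' \<and> (\<forall>i. s' i = (if j \<le> i \<and> i < j + n then Leaf else s i))"
proof (induction n)
  case 0
  show ?case using exec.Skip[of s] by (intro exI[of _ s]) auto
next
  case (Suc n)
  then obtain s' where s': "exec (clear j n) s (1 + 3 * n) s'"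
    "\<forall>i. s' i = (if j \<le> i \<and> i < j + n then Leaf else s i)" by blast
  have "exec (clear j (Suc n)) s (1 + 3 * Suc n) (s'(j + n := Leaf))"
    unfolding clear.simps by (rule exec_SeqI[OF s'(1) exec_AssignI[OF refl]]) simp_all
  moreover have "\<forall>i. (s'(j + n := Leaf)) i = (if j \<le> i \<and> i < j + Suc n then Leaf else s i)"
    using s'(2) by auto
  ultimately show ?case by blast
qed

text \<open>
  \<open>call j P\<close> runs \<open>P\<close> on the variables from \<open>j\<close> on, with argument and result in \<open>j\<close>. Since \<open>P\<close> expects
  all other variables to hold \<open>Leaf\<close>, these are reset first.
\<close>

definition call :: "nat \<Rightarrow> com \<Rightarrow> com" where
  "call j P = Seq (clear (Suc j) (com_bound P)) (rename_com j P)"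

lemma exec_call:
  assumes "computes_in P x T y" "\<sigma> j = x"
  shows "\<exists>t \<sigma>'. exec (call j P) \<sigma> t \<sigma>' \<and> t \<le> T + (3 * com_bound P + 2) \<and> \<sigma>' j = y \<and> (\<forall>i<j. \<sigma>' i = \<sigma> i)"
proof -
  \<comment> \<open>The successor keeps register 0, which carries argument and result, inside the
    mirrored block even if \<open>com_bound P\<close> is 0.\<close>
  define m where "m = Suc (com_bound P)"
  obtain t s where t: "exec P ((\<lambda>_. Leaf)(0 := x)) t s" "t \<le> T" "s 0 = y"
    using assms unfolding computes_in_def by blast
  obtain \<sigma>1 where \<sigma>1: "exec (clear (Suc j) (com_bound P)) \<sigma> (1 + 3 * com_bound P) \<sigma>1"
    "\<forall>i. \<sigma>1 i = (if Suc j \<le> i \<and> i < Suc j + com_bound P then Leaf else \<sigma> i)"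
    using exec_clear by blast
  have "\<forall>i<m. \<sigma>1 (i + j) = ((\<lambda>_. Leaf)(0 := x)) i"
    using \<sigma>1(2) assms(2) unfolding m_def by auto
  then obtain \<sigma>2 where \<sigma>2: "exec (rename_com j P) \<sigma>1 t \<sigma>2"
    "\<forall>i<m. \<sigma>2 (i + j) = s i" "\<forall>i<j. \<sigma>2 i = \<sigma>1 i"
    using exec_rename[OF t(1), of m \<sigma>1 j] unfolding m_def by auto
  have "\<sigma>2 j = y" using \<sigma>2(2) t(3) unfolding m_def by force
  moreover have "\<forall>i<j. \<sigma>2 i = \<sigma> i" using \<sigma>1(2) \<sigma>2(3) by auto
  ultimately show ?thesis
    using exec.Seq[OF \<sigma>1(1) \<sigma>2(1)] t(2) unfolding call_def
    by (intro exI[of _ "1 + (1 + 3 * com_bound P) + t"] exI[of _ \<sigma>2] conjI) (assumption | linarith)+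
qed

lemma computes_in_expr:
  "computes_in (Assign 0 e) x (1 + expr_time e) (expr_val e ((\<lambda>_. Leaf)(0 := x)))"
  unfolding computes_in_def using exec.Assign by fastforce

lemma computes_in_comp:
  assumes "computes_in P x T y" "computes_in Q y T' z"
  shows "computes_in (Seq P (call 0 Q)) x (T + T' + (3 * com_bound Q + 3)) z"
proof -
  obtain t s where 1: "exec P ((\<lambda>_. Leaf)(0 := x)) t s" "t \<le> T" "s 0 = y"
    using assms unfolding computes_in_def by blast
  obtain t' s' where 2: "exec (call 0 Q) s t' s'" "t' \<le> T' + (3 * com_bound Q + 2)" "s' 0 = z"
    using exec_call[OF assms(2), of s 0, OF 1(3)] by blast
  show ?thesis unfolding computes_in_def
    using exec.Seq[OF 1(1) 2(1)] 1(2) 2(2,3)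
    by (intro exI[of _ "1 + t + t'"] exI[of _ s'] conjI) (assumption | linarith)+
qed

text \<open>Register 0 keeps the argument, registers 1 and 2 receive the results. Each call starts
  at the register of its own result and so leaves the earlier ones intact.\<close>

definition pair_com :: "com \<Rightarrow> com \<Rightarrow> com" where
  "pair_com P Q = Seq (Assign 1 (Var 0)) (Seq (call 1 P) (Seq (Assign 2 (Var 0))
     (Seq (call 2 Q) (Assign 0 (NodeE (Var 1) (Var 2))))))"

lemma computes_in_pair:
  assumes "computes_in P x T y" "computes_in Q x T' z"
  shows "computes_in (pair_com P Q) x (T + T' + (3 * com_bound P + 3 * com_bound Q + 20)) (Node y z)"
proof -
  define \<sigma> :: state where "\<sigma> = ((\<lambda>_. Leaf)(0 := x))(1 := x)"
  have 0: "exec (Assign 1 (Var 0)) ((\<lambda>_. Leaf)(0 := x)) 2 \<sigma>"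
    by (rule exec_AssignI) (simp_all add: \<sigma>_def)
  obtain t1 \<sigma>1 where 1: "exec (call 1 P) \<sigma> t1 \<sigma>1" "t1 \<le> T + (3 * com_bound P + 2)" "\<sigma>1 1 = y"
    "\<forall>i<1. \<sigma>1 i = \<sigma> i"
    using exec_call[OF assms(1), of \<sigma> 1] unfolding \<sigma>_def by auto
  define \<tau> where "\<tau> = \<sigma>1(2 := x)"
  have x: "\<sigma>1 0 = x" using 1(4) unfolding \<sigma>_def by simp
  have 2: "exec (Assign 2 (Var 0)) \<sigma>1 2 \<tau>"
    by (rule exec_AssignI) (simp_all add: \<tau>_def x)
  obtain t2 \<sigma>2 where 3: "exec (call 2 Q) \<tau> t2 \<sigma>2" "t2 \<le> T' + (3 * com_bound Q + 2)" "\<sigma>2 2 = z"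
    "\<forall>i<2. \<sigma>2 i = \<tau> i"
    using exec_call[OF assms(2), of \<tau> 2] unfolding \<tau>_def by auto
  have y: "\<sigma>2 1 = y" using 3(4) 1(3) unfolding \<tau>_def by simp
  have 4: "exec (Assign 0 (NodeE (Var 1) (Var 2))) \<sigma>2 4 (\<sigma>2(0 := Node y z))"
    by (rule exec_AssignI) (use y 3(3) in simp_all)
  show ?thesis unfolding computes_in_def pair_com_def
    using exec.Seq[OF 0 exec.Seq[OF 1(1) exec.Seq[OF 2 exec.Seq[OF 3(1) 4]]]] 1(2) 3(2)
    by (intro exI[of _ "1 + 2 + (1 + t1 + (1 + 2 + (1 + t2 + 4)))"] exI[of _ "\<sigma>2(0 := Node y z)"] conjI)
      (assumption | linarith | simp)+
qed

definition cond_com :: "com \<Rightarrow> com \<Rightarrow> com \<Rightarrow> com" where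
  "cond_com B P Q = Seq (Assign 1 (Var 0)) (Seq (call 1 B) (Cond (Var 1) (call 0 P) (call 0 Q)))"

lemma computes_in_cond:
  assumes "computes_in B x T b" "b \<noteq> Leaf \<Longrightarrow> computes_in P x T' y" "b = Leaf \<Longrightarrow> computes_in Q x T' y"
  shows "computes_in (cond_com B P Q) x
    (T + T' + (3 * com_bound B + 3 * com_bound P + 3 * com_bound Q + 20)) y"
proof -
  define \<sigma> :: state where "\<sigma> = ((\<lambda>_. Leaf)(0 := x))(1 := x)"
  have 0: "exec (Assign 1 (Var 0)) ((\<lambda>_. Leaf)(0 := x)) 2 \<sigma>"
    by (rule exec_AssignI) (simp_all add: \<sigma>_def)
  obtain t1 \<sigma>1 where 1: "exec (call 1 B) \<sigma> t1 \<sigma>1" "t1 \<le> T + (3 * com_bound B + 2)" "\<sigma>1 1 = b"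
    "\<forall>i<1. \<sigma>1 i = \<sigma> i"
    using exec_call[OF assms(1), of \<sigma> 1] unfolding \<sigma>_def by auto
  have x: "\<sigma>1 0 = x" using 1(4) unfolding \<sigma>_def by simp
  obtain t2 \<sigma>2 where 2: "exec (Cond (Var 1) (call 0 P) (call 0 Q)) \<sigma>1 t2 \<sigma>2"
    "t2 \<le> T' + (3 * com_bound P + 3 * com_bound Q + 4)" "\<sigma>2 0 = y"
  proof (cases "b = Leaf")
    case True
    obtain t2 \<sigma>2 where 2: "exec (call 0 Q) \<sigma>1 t2 \<sigma>2" "t2 \<le> T' + (3 * com_bound Q + 2)" "\<sigma>2 0 = y"
      using exec_call[OF assms(3)[OF True], of \<sigma>1 0, OF x] by blast
    have "exec (Cond (Var 1) (call 0 P) (call 0 Q)) \<sigma>1 (1 + expr_time (Var 1) + t2) \<sigma>2"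
      by (rule exec.CondFalse) (use True 1(3) 2(1) in auto)
    with 2 show ?thesis by (intro that[of "1 + expr_time (Var 1) + t2" \<sigma>2]) auto
  next
    case False
    obtain t2 \<sigma>2 where 2: "exec (call 0 P) \<sigma>1 t2 \<sigma>2" "t2 \<le> T' + (3 * com_bound P + 2)" "\<sigma>2 0 = y"
      using exec_call[OF assms(2)[OF False], of \<sigma>1 0, OF x] by blast
    have "exec (Cond (Var 1) (call 0 P) (call 0 Q)) \<sigma>1 (1 + expr_time (Var 1) + t2) \<sigma>2"
      by (rule exec.CondTrue) (use False 1(3) 2(1) in auto)
    with 2 show ?thesis by (intro that[of "1 + expr_time (Var 1) + t2" \<sigma>2]) auto
  qed
  show ?thesis unfolding computes_in_def cond_com_def
    using exec.Seq[OF 0 exec.Seq[OF 1(1) 2(1)]] 1(2) 2(2,3)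
    by (intro exI[of _ "1 + 2 + (1 + t1 + t2)"] exI[of _ \<sigma>2] conjI) (assumption | linarith)+
qed

text \<open>The body runs from register 0 on and may destroy the test value in register 1, so the
  test is recomputed at the end of every pass.\<close>

definition while_com :: "com \<Rightarrow> com \<Rightarrow> com" where
  "while_com B P = Seq (Assign 1 (Var 0)) (Seq (call 1 B)
     (While (Var 1) (Seq (call 0 P) (Seq (Assign 1 (Var 0)) (call 1 B)))))"

lemma computes_in_while:
  fixes x :: "nat \<Rightarrow> tree"
  assumes B: "\<And>i. i \<le> N \<Longrightarrow> computes_in B (x i) T (b i)"
    and P: "\<And>i. i < N \<Longrightarrow> computes_in P (x i) T (x (Suc i))"
    and b: "\<And>i. i < N \<Longrightarrow> b i \<noteq> Leaf" "b N = Leaf"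
  shows "computes_in (while_com B P) (x 0) (Suc N * (2 * T + (3 * com_bound B + 3 * com_bound P + 20))) (x N)"
proof -
  let ?C = "2 * T + (3 * com_bound B + 3 * com_bound P + 11)"
  let ?W = "While (Var 1) (Seq (call 0 P) (Seq (Assign 1 (Var 0)) (call 1 B)))"
  have test: "\<exists>t \<sigma>'. exec (Seq (Assign 1 (Var 0)) (call 1 B)) \<sigma> t \<sigma>' \<and>
      t \<le> T + (3 * com_bound B + 5) \<and> \<sigma>' 0 = x i \<and> \<sigma>' 1 = b i" if i: "i \<le> N" "\<sigma> 0 = x i" for i \<sigma>
  proof -
    have 0: "exec (Assign 1 (Var 0)) \<sigma> 2 (\<sigma>(1 := x i))"
      by (rule exec_AssignI) (simp_all add: i)
    obtain t1 \<sigma>1 where 1: "exec (call 1 B) (\<sigma>(1 := x i)) t1 \<sigma>1" "t1 \<le> T + (3 * com_bound B + 2)"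
      "\<sigma>1 1 = b i" "\<forall>j<1. \<sigma>1 j = (\<sigma>(1 := x i)) j"
      using exec_call[OF B[OF i(1)], of "\<sigma>(1 := x i)" 1, OF fun_upd_same] by blast
    have "\<sigma>1 0 = x i" using 1(4) i(2) by simp
    with exec.Seq[OF 0 1(1)] 1(2,3) show ?thesis
      by (intro exI[of _ "1 + 2 + t1"] exI[of _ \<sigma>1] conjI) (assumption | linarith)+
  qed
  \<comment> \<open>Induction on the number \<open>d\<close> of passes that remain:
    \<open>?C\<close> pays for one pass together with the test after it, and 2 for the final failing
    check of register 1.\<close>
  have loop: "\<exists>t \<sigma>'. exec ?W \<sigma> t \<sigma>' \<and> t \<le> d * ?C + 2 \<and> \<sigma>' 0 = x N"
    if "i + d = N" "\<sigma> 0 = x i" "\<sigma> 1 = b i" for i d \<sigma>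
    using that
  proof (induction d arbitrary: i \<sigma>)
    case 0
    then have "exec ?W \<sigma> (1 + expr_time (Var 1)) \<sigma>"
      by (intro exec.WhileFalse) (use b(2) in auto)
    moreover have "\<sigma> 0 = x N" using 0 by simp
    ultimately show ?case by (intro exI[of _ "1 + expr_time (Var 1)"] exI[of _ \<sigma>] conjI) simp_all
  next
    case (Suc d)
    then have i: "i < N" "Suc i \<le> N" "Suc i + d = N" by auto
    obtain t1 \<sigma>1 where 1: "exec (call 0 P) \<sigma> t1 \<sigma>1" "t1 \<le> T + (3 * com_bound P + 2)" "\<sigma>1 0 = x (Suc i)"
      using exec_call[OF P[OF i(1)], of \<sigma> 0, OF Suc.prems(2)] by blast
    obtain t2 \<sigma>2 where 2: "exec (Seq (Assign 1 (Var 0)) (call 1 B)) \<sigma>1 t2 \<sigma>2"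
      "t2 \<le> T + (3 * com_bound B + 5)" "\<sigma>2 0 = x (Suc i)" "\<sigma>2 1 = b (Suc i)"
      using test[of "Suc i" \<sigma>1, OF i(2) 1(3)] by blast
    obtain t3 \<sigma>3 where 3: "exec ?W \<sigma>2 t3 \<sigma>3" "t3 \<le> d * ?C + 2" "\<sigma>3 0 = x N"
      using Suc.IH[of "Suc i" \<sigma>2, OF i(3) 2(3,4)] by blast
    have "exec ?W \<sigma> (1 + expr_time (Var 1) + (1 + t1 + t2) + t3) \<sigma>3"
      by (rule exec.WhileTrue[OF _ exec.Seq[OF 1(1) 2(1)] 3(1)]) (use b(1)[OF i(1)] Suc.prems in auto)
    moreover have "1 + expr_time (Var 1) + (1 + t1 + t2) + t3 \<le> Suc d * ?C + 2"
      using 1(2) 2(2) 3(2) by (simp add: algebra_simps)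
    ultimately show ?case using 3(3) by blast
  qed
  let ?s = "(\<lambda>_. Leaf)(0 := x 0)"
  have 0: "exec (Assign 1 (Var 0)) ?s 2 (?s(1 := x 0))"
    by (rule exec_AssignI) simp_all
  obtain t1 \<sigma>1 where 1: "exec (call 1 B) (?s(1 := x 0)) t1 \<sigma>1" "t1 \<le> T + (3 * com_bound B + 2)"
      "\<sigma>1 1 = b 0" "\<forall>j<1. \<sigma>1 j = (?s(1 := x 0)) j"
    using exec_call[OF B[OF le0], of "?s(1 := x 0)" 1, OF fun_upd_same] by blast
  then have "\<sigma>1 0 = x 0" by simp
  then obtain t2 \<sigma>2 where 2: "exec ?W \<sigma>1 t2 \<sigma>2" "t2 \<le> N * ?C + 2" "\<sigma>2 0 = x N"
    using loop[of 0 N \<sigma>1] 1(3) by auto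
  have "1 + 2 + (1 + t1 + t2) \<le> N * ?C + (2 * T + (3 * com_bound B + 3 * com_bound P + 20))"
    using 1(2) 2(2) by linarith
  also have "\<dots> \<le> Suc N * (2 * T + (3 * com_bound B + 3 * com_bound P + 20))"
    by (simp add: add_mult_distrib2)
  finally show ?thesis unfolding computes_in_def while_com_def
    using exec.Seq[OF 0 exec.Seq[OF 1(1) 2(1)]] 2(3)
    by (intro exI[of _ "1 + 2 + (1 + t1 + t2)"] exI[of _ \<sigma>2] conjI) (assumption | linarith)+
qed

section \<open>Polynomial-time functions on encodable types\<close>

text \<open>No injectivity is asked for: \<open>()\<close>, \<open>False\<close>, \<open>0\<close>
  and \<open>[]\<close> all share the code \<open>Leaf\<close>. Such coincidences are exploited
  later to change types without computing anything.\<close>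

class encodable =
  fixes encode :: "'a \<Rightarrow> tree"

instantiation tree :: encodable
begin
definition "encode (t :: tree) = t"
instance ..
end

instantiation unit :: encodable
begin
definition "encode (u :: unit) = Leaf"
instance ..
end

instantiation bool :: encodable
begin
definition "encode b = (if b then Node Leaf Leaf else Leaf)"
instance ..
end

instantiation nat :: encodable
begin
definition "encode n = enc_nat n"
instance ..
end

instantiation prod :: (encodable, encodable) encodable
begin
definition "encode p = Node (encode (fst p)) (encode (snd p))"
instance ..
end

instantiation list :: (encodable) encodable
begin
definition "encode xs = enc_list (map encode xs)"
instance ..
end

lemma encode_simps [simp]:
  "encode () = Leaf" "encode True = Node Leaf Leaf" "encode False = Leaf"
  "encode (0 :: nat) = Leaf" "encode (Suc n) = Node Leaf (encode n)"
  "encode (a, b) = Node (encode a) (encode b)"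
  "encode [] = Leaf" "encode (x # xs) = Node (encode x) (encode xs)"
  by (simp_all add: encode_unit_def encode_bool_def encode_nat_def encode_prod_def
      encode_list_def enc_nat_def)

abbreviation esize :: "'a::encodable \<Rightarrow> nat" where
  "esize x \<equiv> size (encode x)"

lemma esize_nat [simp]: "esize (n :: nat) = n"
  by (induction n) auto

lemma esize_append: "esize (xs @ ys) = esize xs + esize ys"
  by (induction xs) auto

lemma esize_rev: "esize (rev xs) = esize xs"
  by (induction xs) (auto simp: esize_append)

lemma length_le_esize: "length xs \<le> esize xs"
  by (induction xs) auto

lemma esize_drop_le: "esize (drop i xs) \<le> esize xs"
  using esize_append[of "take i xs" "drop i xs"] by simp

lemma esize_member_less: "x \<in> set xs \<Longrightarrow> esize x < esize xs"
  by (induction xs) auto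

lemma esize_list_le:
  assumes "\<And>x. x \<in> set xs \<Longrightarrow> esize x \<le> m" "length xs \<le> l"
  shows "esize xs \<le> l * Suc m"
proof -
  have "esize xs \<le> length xs * Suc m"
    using assms(1) by (induction xs) (fastforce simp: add_mono)+
  also have "\<dots> \<le> l * Suc m" using assms(2) by (rule mult_le_mono1)
  finally show ?thesis .
qed

lemma esize_concat_le: "esize (concat xss) \<le> esize xss"
  by (induction xss) (auto simp: esize_append)

text \<open>As \<open>esize x + 2\<close> is at least \<open>2\<close>, its powers absorb constants, sums and products.\<close>

definition pbound :: "'a::encodable set \<Rightarrow> ('a \<Rightarrow> nat) \<Rightarrow> bool" where
  "pbound D g \<longleftrightarrow> (\<exists>d. \<forall>x\<in>D. g x \<le> (esize x + 2) ^ d)"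

lemma pbound_mono: "pbound D g \<Longrightarrow> (\<And>x. x \<in> D \<Longrightarrow> f x \<le> g x) \<Longrightarrow> pbound D f"
  unfolding pbound_def by (meson order_trans)

lemma pbound_subset: "pbound E g \<Longrightarrow> D \<subseteq> E \<Longrightarrow> pbound D g"
  unfolding pbound_def by blast

lemma pbound_const: "pbound D (\<lambda>_. c)"
proof -
  have "c \<le> (m + 2) ^ c" for m :: nat
    using less_exp[of c] power_mono[of 2 "m + 2" c] by linarith
  then show ?thesis unfolding pbound_def by blast
qed

lemma pbound_esize: "pbound D esize"
  unfolding pbound_def by (intro exI[of _ 1]) auto

lemma pbound_mult:
  assumes "pbound D f" "pbound D g" shows "pbound D (\<lambda>x. f x * g x)"
proof -
  from assms obtain d e where "\<And>x. x \<in> D \<Longrightarrow> f x \<le> (esize x + 2) ^ d"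
    "\<And>x. x \<in> D \<Longrightarrow> g x \<le> (esize x + 2) ^ e" unfolding pbound_def by blast
  then have "\<forall>x\<in>D. f x * g x \<le> (esize x + 2) ^ (d + e)"
    by (auto simp: power_add intro: mult_le_mono)
  then show ?thesis unfolding pbound_def by blast
qed

text \<open>Sums reduce to products by f + g \<le> (f + 1) * (g + 1), and an added 1 costs one more
  factor of the base, which is at least 2.\<close>

lemma pbound_add:
  assumes "pbound D f" "pbound D g" shows "pbound D (\<lambda>x. f x + g x)"
proof -
  have 1: "pbound D (\<lambda>x. (f x + 1) * (g x + 1))" if "pbound D (\<lambda>x. f x + 1)" "pbound D (\<lambda>x. g x + 1)"
    using pbound_mult[OF that] .
  have 2: "pbound D (\<lambda>x. h x + 1)" if h: "pbound D h" for h
  proof -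
    obtain d where d: "\<And>x. x \<in> D \<Longrightarrow> h x \<le> (esize x + 2) ^ d"
      using h unfolding pbound_def by blast
    have "h x + 1 \<le> (esize x + 2) ^ Suc d" if "x \<in> D" for x
    proof -
      have "(1::nat) \<le> (esize x + 2) ^ d" by (rule one_le_power) simp
      with d[OF that] have "h x + 1 \<le> 2 * (esize x + 2) ^ d" by linarith
      also have "\<dots> \<le> (esize x + 2) ^ Suc d" by simp
      finally show ?thesis .
    qed
    then show ?thesis unfolding pbound_def by blast
  qed
  show ?thesis by (rule pbound_mono[OF 1[OF 2[OF assms(1)] 2[OF assms(2)]]]) simp
qed

lemma pbound_Suc: "pbound D f \<Longrightarrow> pbound D (\<lambda>x. Suc (f x))"
  using pbound_add[OF _ pbound_const[of D 1]] by simp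

lemma pbound_power: "pbound D f \<Longrightarrow> pbound D (\<lambda>x. f x ^ n)"
  by (induction n) (auto intro: pbound_mult pbound_const)

lemmas pbound_intros =
  pbound_const pbound_esize pbound_add pbound_mult pbound_Suc pbound_power

text \<open>A bound for \<open>g\<close> speaks of the size of \<open>f x\<close>, so that size must
  itself be polynomial in the size of \<open>x\<close>. This is where the size bound contained in
  \<open>pt\<close> is consumed.\<close>

lemma pbound_comp:
  assumes "pbound E g" "pbound D (\<lambda>x. esize (f x))" "\<And>x. x \<in> D \<Longrightarrow> f x \<in> E"
  shows "pbound D (\<lambda>x. g (f x))"
proof -
  obtain d where d: "\<And>x. x \<in> E \<Longrightarrow> g x \<le> (esize x + 2) ^ d"
    using assms(1) unfolding pbound_def by blast
  show ?thesis
    by (rule pbound_mono[where g = "\<lambda>x. (esize (f x) + 2) ^ d"])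
      (intro pbound_intros assms(2), intro d assms(3))
qed

text \<open>
  The time bound does not limit the size of the result, since \<open>NodeE (Var x) (Var x)\<close> doubles a tree
  in constant time. Hence the size of the result is bounded separately.
\<close>

definition pt :: "'a::encodable set \<Rightarrow> ('a \<Rightarrow> 'b::encodable) \<Rightarrow> bool" where
  "pt D f \<longleftrightarrow> pbound D (\<lambda>x. esize (f x)) \<and>
     (\<exists>P T. pbound D T \<and> (\<forall>x\<in>D. computes_in P (encode x) (T x) (encode (f x))))"

lemma pt_esize: "pt D f \<Longrightarrow> pbound D (\<lambda>x. esize (f x))"
  unfolding pt_def by blast

lemma ptI:
  assumes "pbound D (\<lambda>x. esize (f x))" "pbound D T"
    "\<And>x. x \<in> D \<Longrightarrow> computes_in P (encode x) (T x) (encode (f x))"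
  shows "pt D f"
  using assms unfolding pt_def by blast

lemma ptE:
  assumes "pt D f"
  obtains P T where "pbound D T" "\<And>x. x \<in> D \<Longrightarrow> computes_in P (encode x) (T x) (encode (f x))"
  using assms unfolding pt_def by blast

lemma pt_subset: "pt E f \<Longrightarrow> D \<subseteq> E \<Longrightarrow> pt D f"
  unfolding pt_def by (meson pbound_subset subsetD)

text \<open>A program sees only codes, so functions with different result types but equal codes are
  computed by the same program.\<close>

lemma pt_code:
  assumes "pt D f" "\<And>x. x \<in> D \<Longrightarrow> encode (g x) = encode (f x)"
  shows "pt D g"
proof -
  obtain P T where "pbound D T" "\<And>x. x \<in> D \<Longrightarrow> computes_in P (encode x) (T x) (encode (f x))"
    using ptE[OF assms(1)] by blast
  moreover have "pbound D (\<lambda>x. esize (g x))"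
    using pbound_mono[OF pt_esize[OF assms(1)]] assms(2) by simp
  ultimately show ?thesis using assms(2) by (intro ptI[of D g T P]) auto
qed

lemma pt_cong: "pt D f \<Longrightarrow> (\<And>x. x \<in> D \<Longrightarrow> g x = f x) \<Longrightarrow> pt D g"
  by (rule pt_code) auto

lemma pt_expr:
  assumes "pbound D (\<lambda>x. esize (f x))"
    "\<And>x. x \<in> D \<Longrightarrow> expr_val e ((\<lambda>_. Leaf)(0 := encode x)) = encode (f x)"
  shows "pt D f"
proof (rule ptI[where T = "\<lambda>_. 1 + expr_time e" and P = "Assign 0 e"])
  show "computes_in (Assign 0 e) (encode x) (1 + expr_time e) (encode (f x))" if "x \<in> D" for x
    using computes_in_expr[of e "encode x"] unfolding assms(2)[OF that] .
qed (intro assms(1) pbound_const)+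

lemma pt_comp:
  assumes g: "pt E g" and f: "pt D f" and sub: "\<And>x. x \<in> D \<Longrightarrow> f x \<in> E"
  shows "pt D (\<lambda>x. g (f x))"
proof -
  obtain P T where P: "pbound D T" "\<And>x. x \<in> D \<Longrightarrow> computes_in P (encode x) (T x) (encode (f x))"
    using ptE[OF f] by blast
  obtain Q U where Q: "pbound E U" "\<And>x. x \<in> E \<Longrightarrow> computes_in Q (encode x) (U x) (encode (g x))"
    using ptE[OF g] by blast
  show ?thesis
  proof (rule ptI)
    show "pbound D (\<lambda>x. esize (g (f x)))"
      using pbound_comp[OF pt_esize[OF g] pt_esize[OF f] sub] .
    show "pbound D (\<lambda>x. T x + U (f x) + (3 * com_bound Q + 3))"
      by (intro pbound_add pbound_const P(1) pbound_comp[OF Q(1) pt_esize[OF f] sub])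
    show "computes_in (Seq P (call 0 Q)) (encode x) (T x + U (f x) + (3 * com_bound Q + 3))
      (encode (g (f x)))" if "x \<in> D" for x
      using computes_in_comp[OF P(2)[OF that] Q(2)[OF sub[OF that]]] .
  qed
qed

lemma pt_id: "pt D (\<lambda>x. x)"
  by (rule pt_expr[where e = "Var 0"]) (auto intro: pbound_esize)

fun tree_expr :: "tree \<Rightarrow> expr" where
  "tree_expr Leaf = LeafE"
| "tree_expr (Node l r) = NodeE (tree_expr l) (tree_expr r)"

lemma expr_val_tree_expr [simp]: "expr_val (tree_expr t) s = t"
  by (induction t) auto

lemma pt_const: "pt D (\<lambda>_. c)"
  by (rule pt_expr[where e = "tree_expr (encode c)"]) (auto intro: pbound_const)

lemma pt_Pair:
  assumes "pt D f" "pt D g"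
  shows "pt D (\<lambda>x. (f x, g x))"
proof -
  obtain P T where P: "pbound D T" "\<And>x. x \<in> D \<Longrightarrow> computes_in P (encode x) (T x) (encode (f x))"
    using ptE[OF assms(1)] by blast
  obtain Q U where Q: "pbound D U" "\<And>x. x \<in> D \<Longrightarrow> computes_in Q (encode x) (U x) (encode (g x))"
    using ptE[OF assms(2)] by blast
  show ?thesis
  proof (rule ptI)
    show "pbound D (\<lambda>x. esize (f x, g x))"
      by (rule pbound_mono[where g = "\<lambda>x. Suc (esize (f x) + esize (g x))"])
        (intro pbound_Suc pbound_add assms[THEN pt_esize], simp)
    show "pbound D (\<lambda>x. T x + U x + (3 * com_bound P + 3 * com_bound Q + 20))"
      by (intro pbound_add pbound_const P(1) Q(1))
    show "computes_in (pair_com P Q) (encode x)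
      (T x + U x + (3 * com_bound P + 3 * com_bound Q + 20)) (encode (f x, g x))" if "x \<in> D" for x
      using computes_in_pair[OF P(2)[OF that] Q(2)[OF that]] by simp
  qed
qed

lemma pt_via_expr:
  assumes "pt D f"
    "\<And>x. x \<in> D \<Longrightarrow> expr_val e ((\<lambda>_. Leaf)(0 := encode (f x))) = encode (g x)"
    "\<And>x. x \<in> D \<Longrightarrow> esize (g x) \<le> Suc (Suc (esize (f x)))"
  shows "pt D g"
proof -
  obtain P T where P: "pbound D T" "\<And>x. x \<in> D \<Longrightarrow> computes_in P (encode x) (T x) (encode (f x))"
    using ptE[OF assms(1)] by blast
  show ?thesis
  proof (rule ptI)
    show "pbound D (\<lambda>x. esize (g x))"
      by (rule pbound_mono[OF _ assms(3)]) (intro pbound_Suc pt_esize[OF assms(1)], assumption)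
    show "pbound D (\<lambda>x. T x + (1 + expr_time e) + (3 * com_bound (Assign 0 e) + 3))"
      by (intro pbound_add pbound_const P(1))
    show "computes_in (Seq P (call 0 (Assign 0 e))) (encode x)
      (T x + (1 + expr_time e) + (3 * com_bound (Assign 0 e) + 3)) (encode (g x))" if "x \<in> D" for x
      using computes_in_comp[OF P(2)[OF that] computes_in_expr[of e]] unfolding assms(2)[OF that] .
  qed
qed

lemma pt_fst: "pt D f \<Longrightarrow> pt D (\<lambda>x. fst (f x))"
  by (erule pt_via_expr[where e = "Hd (Var 0)"]) (auto simp: encode_prod_def)

lemma pt_snd: "pt D f \<Longrightarrow> pt D (\<lambda>x. snd (f x))"
  by (erule pt_via_expr[where e = "Tl (Var 0)"]) (auto simp: encode_prod_def)

lemma pt_hd: "pt D f \<Longrightarrow> (\<And>x. x \<in> D \<Longrightarrow> f x \<noteq> []) \<Longrightarrow> pt D (\<lambda>x. hd (f x))"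
proof (erule pt_via_expr[where e = "Hd (Var 0)"])
  assume ne: "\<And>x. x \<in> D \<Longrightarrow> f x \<noteq> []"
  fix x assume "x \<in> D"
  then obtain y ys where "f x = y # ys" using ne by (metis neq_Nil_conv)
  then show "expr_val (Hd (Var 0)) ((\<lambda>_. Leaf)(0 := encode (f x))) = encode (hd (f x))"
    "esize (hd (f x)) \<le> Suc (Suc (esize (f x)))" by simp_all
qed

lemma pt_tl: "pt D f \<Longrightarrow> pt D (\<lambda>x. tl (f x))"
  by (erule pt_via_expr[where e = "Tl (Var 0)"]) (case_tac "f x"; simp)+

lemma pt_pred: "pt D f \<Longrightarrow> pt D (\<lambda>x. f x - (1::nat))"
  by (erule pt_via_expr[where e = "Tl (Var 0)"]) (case_tac "f x"; simp)+

lemma pt_Suc: "pt D f \<Longrightarrow> pt D (\<lambda>x. Suc (f x))"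
  by (erule pt_via_expr[where e = "NodeE LeafE (Var 0)"]) simp_all

lemma pt_Cons: "pt D f \<Longrightarrow> pt D g \<Longrightarrow> pt D (\<lambda>x. f x # g x)"
  by (rule pt_code[OF pt_Pair[of D f g]]) simp_all

text \<open>Each branch has to be polynomial only on the inputs that reach it; this is how guards
  later shield partial functions and the constraint checker. Testing the code against
  \<open>Leaf\<close> covers lists, numbers and booleans alike.\<close>

lemma pt_test:
  assumes b: "pt D b" and f: "pt {x \<in> D. encode (b x) \<noteq> Leaf} f"
    and g: "pt {x \<in> D. encode (b x) = Leaf} g"
    and hf: "\<And>x. x \<in> D \<Longrightarrow> encode (b x) \<noteq> Leaf \<Longrightarrow> h x = f x"
    and hg: "\<And>x. x \<in> D \<Longrightarrow> encode (b x) = Leaf \<Longrightarrow> h x = g x"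
  shows "pt D h"
proof -
  let ?E = "{x \<in> D. encode (b x) \<noteq> Leaf}" and ?F = "{x \<in> D. encode (b x) = Leaf}"
  \<comment> \<open>The exponents on the two halves may differ; the sum of the two powers dominates
    both.\<close>
  have split: "pbound D u" if "pbound ?E u" "pbound ?F u" for u
  proof -
    from that obtain d e where d: "\<forall>x\<in>?E. u x \<le> (esize x + 2) ^ d"
      and e: "\<forall>x\<in>?F. u x \<le> (esize x + 2) ^ e" unfolding pbound_def by blast
    have "u x \<le> (esize x + 2) ^ d + (esize x + 2) ^ e" if "x \<in> D" for x
      using that d e by (cases "encode (b x) = Leaf") (auto intro: trans_le_add1 trans_le_add2)
    then show ?thesis
      by (rule pbound_mono[where g = "\<lambda>x. (esize x + 2) ^ d + (esize x + 2) ^ e", rotated])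
        (assumption, intro pbound_intros)
  qed
  obtain B S where B: "pbound D S" "\<And>x. x \<in> D \<Longrightarrow> computes_in B (encode x) (S x) (encode (b x))"
    using ptE[OF b] by blast
  obtain P T where P: "pbound ?E T" "\<And>x. x \<in> ?E \<Longrightarrow> computes_in P (encode x) (T x) (encode (f x))"
    using ptE[OF f] by blast
  obtain Q U where Q: "pbound ?F U" "\<And>x. x \<in> ?F \<Longrightarrow> computes_in Q (encode x) (U x) (encode (g x))"
    using ptE[OF g] by blast
  let ?T = "\<lambda>x. if encode (b x) = Leaf then U x else T x"
  have "pbound D ?T"
    by (rule split) (auto intro: pbound_mono[OF P(1)] pbound_mono[OF Q(1)])
  moreover have "pbound D (\<lambda>x. esize (h x))"
    by (rule split) (auto intro: pbound_mono[OF pt_esize[OF f]] pbound_mono[OF pt_esize[OF g]]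
        simp: hf hg)
  moreover have "computes_in (cond_com B P Q) (encode x)
      (S x + ?T x + (3 * com_bound B + 3 * com_bound P + 3 * com_bound Q + 20)) (encode (h x))"
    if "x \<in> D" for x
    by (rule computes_in_cond[OF B(2)[OF that]]) (use that P(2) Q(2) hf hg in auto)
  moreover from calculation(1) have "pbound D (\<lambda>x. S x + ?T x +
      (3 * com_bound B + 3 * com_bound P + 3 * com_bound Q + 20))"
    by (intro pbound_add pbound_const B(1))
  ultimately show ?thesis using ptI[of D h] by blast
qed

lemma pt_if:
  assumes "pt D b" "pt {x \<in> D. b x} f" "pt {x \<in> D. \<not> b x} g"
  shows "pt D (\<lambda>x. if b x then f x else g x)"
proof -
  have *: "encode (b x) = Leaf \<longleftrightarrow> \<not> b x" for x by (cases "b x") auto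
  show ?thesis by (rule pt_test[where b = b and f = f and g = g]) (use assms * in auto)
qed

text \<open>Neither the number \<open>N\<close> of passes nor the size \<open>S\<close> of the
  states is assumed polynomial, so the rule serves the polynomial folds as well as the exponential
  search. The program and the exponent depend on the loop alone.\<close>

lemma pt_while:
  fixes t :: "'a::encodable \<Rightarrow> 'b::encodable"
  assumes t: "pt D t" and f: "pt {x \<in> D. encode (t x) \<noteq> Leaf} f"
  shows "\<exists>P d. \<forall>x N S. (\<forall>i\<le>N. (f ^^ i) x \<in> D \<and> esize ((f ^^ i) x) \<le> S) \<longrightarrow>
    (\<forall>i<N. encode (t ((f ^^ i) x)) \<noteq> Leaf) \<longrightarrow> encode (t ((f ^^ N) x)) = Leaf \<longrightarrow>
    computes_in P (encode x) (Suc N * (S + 2) ^ d) (encode ((f ^^ N) x))"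
proof -
  let ?E = "{x \<in> D. encode (t x) \<noteq> Leaf}"
  obtain B T where B: "pbound D T" "\<And>x. x \<in> D \<Longrightarrow> computes_in B (encode x) (T x) (encode (t x))"
    using ptE[OF t] by blast
  obtain P U where P: "pbound ?E U" "\<And>x. x \<in> ?E \<Longrightarrow> computes_in P (encode x) (U x) (encode (f x))"
    using ptE[OF f] by blast
  obtain d1 where d1: "\<And>x. x \<in> D \<Longrightarrow> T x \<le> (esize x + 2) ^ d1"
    using B(1) unfolding pbound_def by blast
  obtain d2 where d2: "\<And>x. x \<in> ?E \<Longrightarrow> U x \<le> (esize x + 2) ^ d2"
    using P(1) unfolding pbound_def by blast
  have "pbound UNIV (\<lambda>S::nat. 2 * ((esize S + 2) ^ d1 + (esize S + 2) ^ d2) +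
      (3 * com_bound B + 3 * com_bound P + 20))"
    by (intro pbound_intros)
  then obtain d where d: "\<And>S. 2 * ((S + 2) ^ d1 + (S + 2) ^ d2) +
      (3 * com_bound B + 3 * com_bound P + 20) \<le> (S + 2) ^ d"
    unfolding pbound_def by auto
  have "computes_in (while_com B P) (encode x) (Suc N * (S + 2) ^ d) (encode ((f ^^ N) x))"
    if 1: "\<forall>i\<le>N. (f ^^ i) x \<in> D \<and> esize ((f ^^ i) x) \<le> S"
      and 2: "\<forall>i<N. encode (t ((f ^^ i) x)) \<noteq> Leaf" and 3: "encode (t ((f ^^ N) x)) = Leaf" for x N S
  proof -
    let ?T = "(S + 2) ^ d1 + (S + 2) ^ d2"
    have "computes_in B (encode ((f ^^ i) x)) ?T (encode (t ((f ^^ i) x)))" if "i \<le> N" for i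
    proof (rule computes_in_mono[OF B(2)])
      have "T ((f ^^ i) x) \<le> (esize ((f ^^ i) x) + 2) ^ d1" using 1 that d1 by auto
      also have "\<dots> \<le> (S + 2) ^ d1" by (rule power_mono) (use 1 that in auto)
      finally show "T ((f ^^ i) x) \<le> ?T" by linarith
    qed (use 1 that in auto)
    moreover have "computes_in P (encode ((f ^^ i) x)) ?T (encode ((f ^^ Suc i) x))" if "i < N" for i
      unfolding funpow.simps o_def
    proof (rule computes_in_mono[OF P(2)])
      have "U ((f ^^ i) x) \<le> (esize ((f ^^ i) x) + 2) ^ d2" using 1 2 that d2 by auto
      also have "\<dots> \<le> (S + 2) ^ d2" by (rule power_mono) (use 1 that in auto)
      finally show "U ((f ^^ i) x) \<le> ?T" by linarith
    qed (use 1 2 that in auto)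
    ultimately have "computes_in (while_com B P) (encode ((f ^^ 0) x))
        (Suc N * (2 * ?T + (3 * com_bound B + 3 * com_bound P + 20))) (encode ((f ^^ N) x))"
      using 2 3 by (intro computes_in_while[where x = "\<lambda>i. encode ((f ^^ i) x)" and
          b = "\<lambda>i. encode (t ((f ^^ i) x))"]) blast+
    then have "computes_in (while_com B P) (encode x)
        (Suc N * (2 * ?T + (3 * com_bound B + 3 * com_bound P + 20))) (encode ((f ^^ N) x))"
      by simp
    then show ?thesis using mult_le_mono2[OF d[of S]] by (rule computes_in_mono)
  qed
  then show ?thesis by blast
qed

text \<open>A step of polynomial growth may blow up under iteration, so the bound \<open>B\<close>
  is required for the accumulator after every prefix of the list. The loop state consists of the
  argument, the remaining list and the accumulator.\<close>

lemma pt_fold: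
  fixes l :: "'a::encodable \<Rightarrow> 'b::encodable list" and a :: "'a \<Rightarrow> 'c::encodable"
  assumes F: "pt {z. fst z \<in> D \<and> fst (snd z) \<in> set (l (fst z))}
      (\<lambda>z. F (fst z) (fst (snd z)) (snd (snd z)))"
    and l: "pt D l" and a: "pt D a" and B: "pbound D B"
    and le: "\<And>x ys zs. x \<in> D \<Longrightarrow> l x = ys @ zs \<Longrightarrow> esize (fold (F x) ys (a x)) \<le> B x"
  shows "pt D (\<lambda>x. fold (F x) (l x) (a x))"
proof -
  define E :: "('a \<times> 'b list \<times> 'c) set" where "E = {z. fst z \<in> D \<and> (\<exists>ys. l (fst z) = ys @ fst (snd z))}"
  define f :: "'a \<times> 'b list \<times> 'c \<Rightarrow> 'a \<times> 'b list \<times> 'c" where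
    "f z = (fst z, tl (fst (snd z)), F (fst z) (hd (fst (snd z))) (snd (snd z)))" for z
  let ?E = "{z \<in> E. encode (fst (snd z)) \<noteq> Leaf}"
  have ne: "fst (snd z) \<noteq> []" if "z \<in> ?E" for z using that by auto
  have mem: "fst z \<in> D \<and> hd (fst (snd z)) \<in> set (l (fst z))" if "z \<in> ?E" for z
    using that ne[OF that] unfolding E_def by (auto intro!: disjI2 hd_in_set)
  have "pt ?E (\<lambda>z. (fst z, hd (fst (snd z)), snd (snd z)))"
    by (intro pt_Pair pt_fst pt_snd pt_hd pt_id ne)
  from pt_comp[OF F this] have "pt ?E (\<lambda>z. F (fst z) (hd (fst (snd z))) (snd (snd z)))"
    using mem by simp
  then have "pt ?E f" unfolding f_def
    by (intro pt_Pair pt_fst pt_snd pt_tl pt_id)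
  moreover have "pt E (\<lambda>z. fst (snd z))" by (intro pt_fst pt_snd pt_id)
  ultimately obtain P d where P: "\<And>x N S. (\<And>i. i \<le> N \<Longrightarrow> (f ^^ i) x \<in> E \<and> esize ((f ^^ i) x) \<le> S) \<Longrightarrow>
    (\<And>i. i < N \<Longrightarrow> encode (fst (snd ((f ^^ i) x))) \<noteq> Leaf) \<Longrightarrow> encode (fst (snd ((f ^^ N) x))) = Leaf \<Longrightarrow>
    computes_in P (encode x) (Suc N * (S + 2) ^ d) (encode ((f ^^ N) x))"
    using pt_while[of E "\<lambda>z. fst (snd z)" f] by blast
  have iter: "(f ^^ i) (x, l x, a x) = (x, drop i (l x), fold (F x) (take i (l x)) (a x))"
    if "i \<le> length (l x)" for i x
    using that
  proof (induction i)
    case (Suc i)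
    then show ?case
      by (simp add: f_def take_Suc_conv_app_nth hd_drop_conv_nth tl_drop drop_Suc flip: tl_drop)
  qed simp
  \<comment> \<open>Bounds every state of the loop: the argument, a suffix of the list, an
    accumulator and two pairing nodes.\<close>
  let ?S = "\<lambda>x. esize x + esize (l x) + B x + 2"
  have run: "computes_in P (encode (x, l x, a x)) (Suc (length (l x)) * (?S x + 2) ^ d)
      (encode (x, [] :: 'b list, fold (F x) (l x) (a x)))" if "x \<in> D" for x
  proof -
    have "(f ^^ i) (x, l x, a x) \<in> E \<and> esize ((f ^^ i) (x, l x, a x)) \<le> ?S x" if i: "i \<le> length (l x)" for i
    proof
      show "(f ^^ i) (x, l x, a x) \<in> E"
        unfolding iter[OF i] E_def using \<open>x \<in> D\<close> by (auto intro: exI[of _ "take i (l x)"])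
      show "esize ((f ^^ i) (x, l x, a x)) \<le> ?S x"
        using le[OF \<open>x \<in> D\<close>, of "take i (l x)" "drop i (l x)"] esize_drop_le[of i "l x"]
        unfolding iter[OF i] by simp
    qed
    moreover have "encode (fst (snd ((f ^^ i) (x, l x, a x)))) \<noteq> Leaf" if "i < length (l x)" for i
      using that iter[of i x] by (cases "drop i (l x)") auto
    ultimately have "computes_in P (encode (x, l x, a x)) (Suc (length (l x)) * (?S x + 2) ^ d)
      (encode ((f ^^ length (l x)) (x, l x, a x)))"
      using iter[of "length (l x)" x] by (intro P) auto
    then show ?thesis using iter[of "length (l x)" x] by simp
  qed
  obtain Q T where Q: "pbound D T"
    "\<And>x. x \<in> D \<Longrightarrow> computes_in Q (encode x) (T x) (encode (x, l x, a x))"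
    using ptE[OF pt_Pair[OF pt_id pt_Pair[OF l a]]] by blast
  have "pt D (\<lambda>x. (x, [] :: 'b list, fold (F x) (l x) (a x)))"
  proof (rule ptI)
    show "pbound D (\<lambda>x. esize (x, [] :: 'b list, fold (F x) (l x) (a x)))"
      by (rule pbound_mono[where g = "\<lambda>x. esize x + B x + 2"])
        (use le[of _ _ "[]"] B in \<open>auto intro!: pbound_intros\<close>)
    show "computes_in (Seq Q (call 0 P)) (encode x)
      (T x + Suc (length (l x)) * (?S x + 2) ^ d + (3 * com_bound P + 3))
      (encode (x, [] :: 'b list, fold (F x) (l x) (a x)))" if "x \<in> D" for x
      using computes_in_comp[OF Q(2) run] that by blast
    show "pbound D (\<lambda>x. T x + Suc (length (l x)) * (?S x + 2) ^ d + (3 * com_bound P + 3))"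
      by (intro pbound_intros Q(1) B pt_esize[OF l] pbound_mono[OF pt_esize[OF l] length_le_esize])
  qed
  then have "pt D (\<lambda>x. snd (snd (x, [] :: 'b list, fold (F x) (l x) (a x))))"
    by (intro pt_snd)
  then show ?thesis by simp
qed

section \<open>Polynomial-time operations on lists, numbers and booleans\<close>

lemma pt_app1: "pt UNIV g \<Longrightarrow> pt D a \<Longrightarrow> pt D (\<lambda>x. g (a x))"
  by (rule pt_comp) auto

text \<open>Several arguments are treated as one nested tuple. As the premise on the operation lives
  on \<open>UNIV\<close>, the operation can be analysed once and then applied to arbitrary
  polynomial-time arguments.\<close>

lemma pt_app2:
  "pt UNIV (\<lambda>z. g (fst z) (snd z)) \<Longrightarrow> pt D a \<Longrightarrow> pt D b \<Longrightarrow> pt D (\<lambda>x. g (a x) (b x))"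
  using pt_app1[OF _ pt_Pair, of "\<lambda>z. g (fst z) (snd z)" D a b] by simp

lemma pt_app3:
  "pt UNIV (\<lambda>z. g (fst z) (fst (snd z)) (snd (snd z))) \<Longrightarrow> pt D a \<Longrightarrow> pt D b \<Longrightarrow> pt D c \<Longrightarrow>
    pt D (\<lambda>x. g (a x) (b x) (c x))"
  using pt_app2[OF _ _ pt_Pair, of "\<lambda>x z. g x (fst z) (snd z)" D a b c] by simp

lemma pt_app4:
  "pt UNIV (\<lambda>z. g (fst z) (fst (snd z)) (fst (snd (snd z))) (snd (snd (snd z)))) \<Longrightarrow>
    pt D a \<Longrightarrow> pt D b \<Longrightarrow> pt D c \<Longrightarrow> pt D d \<Longrightarrow> pt D (\<lambda>x. g (a x) (b x) (c x) (d x))"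
  using pt_app3[OF _ _ _ pt_Pair, of "\<lambda>x y z. g x y (fst z) (snd z)" D a b c d] by simp

lemma pt_app5:
  "pt UNIV (\<lambda>z. g (fst z) (fst (snd z)) (fst (snd (snd z))) (fst (snd (snd (snd z))))
      (snd (snd (snd (snd z))))) \<Longrightarrow>
    pt D a \<Longrightarrow> pt D b \<Longrightarrow> pt D c \<Longrightarrow> pt D d \<Longrightarrow> pt D e \<Longrightarrow>
    pt D (\<lambda>x. g (a x) (b x) (c x) (d x) (e x))"
  using pt_app4[OF _ _ _ _ pt_Pair, of "\<lambda>x y u z. g x y u (fst z) (snd z)" D a b c d e] by simp

lemma pt_rev:
  assumes "pt D l" shows "pt D (\<lambda>x. rev (l x))"
proof (rule pt_app1[OF _ assms])
  have "pt UNIV (\<lambda>l::'b list. fold (\<lambda>e acc. e # acc) l [])"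
    by (rule pt_fold[where B = esize])
      (intro pt_Cons pt_fst pt_snd pt_id pt_const pbound_intros |
        simp add: fold_Cons_rev esize_rev esize_append)+
  then show "pt UNIV (rev :: 'b list \<Rightarrow> 'b list)"
    by (rule pt_cong) (simp add: fold_Cons_rev)
qed

lemma pt_append:
  assumes "pt D f" "pt D g" shows "pt D (\<lambda>x. f x @ g x)"
proof (rule pt_app2[OF _ assms])
  have "pt UNIV (\<lambda>z::'b list \<times> 'b list. fold (\<lambda>e acc. e # acc) (rev (fst z)) (snd z))"
    by (rule pt_fold[where B = esize])
      (intro pt_Cons pt_rev pt_fst pt_snd pt_id pt_const pbound_intros |
        auto simp: fold_Cons_rev esize_rev esize_append rev_swap)+
  then show "pt UNIV (\<lambda>z::'b list \<times> 'b list. fst z @ snd z)"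
    by (rule pt_cong) (simp add: fold_Cons_rev)
qed

lemma pt_map:
  fixes l :: "'a::encodable \<Rightarrow> 'b::encodable list" and f :: "'a \<Rightarrow> 'b \<Rightarrow> 'c::encodable"
  assumes f: "pt {z. fst z \<in> D \<and> snd z \<in> set (l (fst z))} (\<lambda>z. f (fst z) (snd z))" and l: "pt D l"
  shows "pt D (\<lambda>x. map (f x) (l x))"
proof -
  let ?E = "{z. fst z \<in> D \<and> snd z \<in> set (l (fst z))}"
  obtain d where "\<And>z. z \<in> ?E \<Longrightarrow> esize (f (fst z) (snd z)) \<le> (esize z + 2) ^ d"
    using pt_esize[OF f] unfolding pbound_def by blast
  then have d: "esize (f x e) \<le> (esize (x, e) + 2) ^ d" if "x \<in> D" "e \<in> set (l x)" for x e
    using that by (metis (mono_tags, lifting) fst_conv mem_Collect_eq snd_conv)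
  \<comment> \<open>A member is smaller than its list, so one bound in terms of \<open>x\<close> and
    \<open>l x\<close> serves for all images.\<close>
  let ?B = "\<lambda>x. (esize x + esize (l x) + 2) ^ d"
  have B: "esize (f x e) \<le> ?B x" if "x \<in> D" "e \<in> set (l x)" for x e
  proof -
    have "esize (x, e) + 2 \<le> esize x + esize (l x) + 2" using esize_member_less[OF that(2)] by simp
    then show ?thesis using d[OF that] power_mono[of "esize (x, e) + 2" _ d] le_trans by blast
  qed
  have "fold (\<lambda>e acc. f x e # acc) ys zs = rev (map (f x) ys) @ zs" for x ys zs
    by (induction ys arbitrary: zs) auto
  then have eq: "fold (\<lambda>e acc. f x e # acc) ys [] = rev (map (f x) ys)" for x ys
    by simp
  have "pt D (\<lambda>x. fold (\<lambda>e acc. f x e # acc) (l x) [])"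
  proof (rule pt_fold[where B = "\<lambda>x. esize (l x) * Suc (?B x)"])
    let ?E' = "{z. fst z \<in> D \<and> fst (snd z) \<in> set (l (fst z))} :: ('a \<times> 'b \<times> 'c list) set"
    have "pt ?E' (\<lambda>z. f (fst z) (fst (snd z)))"
      using pt_comp[OF f, where f = "\<lambda>z. (fst z, fst (snd z))" and D = ?E']
      by (simp add: pt_Pair pt_fst pt_snd pt_id)
    then show "pt ?E' (\<lambda>z. f (fst z) (fst (snd z)) # snd (snd z))"
      by (intro pt_Cons pt_snd pt_id)
    show "pbound D (\<lambda>x. esize (l x) * Suc (?B x))"
      by (intro pbound_intros pt_esize[OF l])
    show "esize (fold (\<lambda>e acc. f x e # acc) ys []) \<le> esize (l x) * Suc (?B x)"
      if x: "x \<in> D" "l x = ys @ zs" for x ys zs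
      unfolding eq
    proof (rule esize_list_le)
      show "length (rev (map (f x) ys)) \<le> esize (l x)"
        using length_le_esize[of ys] x(2) by (simp add: esize_append)
      show "esize y \<le> ?B x" if "y \<in> set (rev (map (f x) ys))" for y
      proof -
        from that obtain e where e: "e \<in> set ys" "y = f x e" by auto
        then have "e \<in> set (l x)" using x(2) by simp
        then show ?thesis unfolding e(2) by (rule B[OF x(1)])
      qed
    qed
  qed (intro l pt_const)+
  from pt_rev[OF this] show ?thesis unfolding eq by simp
qed

lemma pt_concat:
  assumes "pt D l" shows "pt D (\<lambda>x. concat (l x))"
proof (rule pt_app1[OF _ assms])
  have eq: "fold (\<lambda>e acc. acc @ e) l xs = xs @ concat l" for l and xs :: "'b list"
    by (induction l arbitrary: xs) auto
  have "pt UNIV (\<lambda>l::'b list list. fold (\<lambda>e acc. acc @ e) l [])"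
    by (rule pt_fold[where B = esize])
      (intro pt_append pt_fst pt_snd pt_id pt_const pbound_intros |
        use esize_concat_le in \<open>force simp: eq esize_append intro: trans_le_add1\<close>)+
  then show "pt UNIV (concat :: 'b list list \<Rightarrow> 'b list)"
    by (rule pt_cong) (simp add: eq)
qed

lemma pt_filter:
  assumes f: "pt {z. fst z \<in> D \<and> snd z \<in> set (l (fst z))} (\<lambda>z. f (fst z) (snd z))" and l: "pt D l"
  shows "pt D (\<lambda>x. filter (f x) (l x))"
proof -
  have eq: "filter P xs = concat (map (\<lambda>e. if P e then [e] else []) xs)" for P and xs :: "'b list"
    by (induction xs) auto
  show ?thesis unfolding eq
    by (intro pt_concat pt_map pt_if pt_Cons pt_const pt_snd pt_id f l)
qed

lemma encode_eq_Leaf_iff: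
  "encode l = Leaf \<longleftrightarrow> l = []" "encode n = Leaf \<longleftrightarrow> n = (0::nat)" "encode b = Leaf \<longleftrightarrow> \<not> b"
    apply (cases l; simp)
   apply (cases n; simp)
  apply (cases b; simp)
  done

lemma pt_null: "pt D l \<Longrightarrow> pt D (\<lambda>x. l x = [])"
  by (rule pt_test[where b = l and f = "\<lambda>_. False" and g = "\<lambda>_. True"])
    (auto intro: pt_const simp: encode_eq_Leaf_iff)

lemma pt_eq_0: "pt D f \<Longrightarrow> pt D (\<lambda>x. f x = (0::nat))"
  by (rule pt_test[where b = f and f = "\<lambda>_. False" and g = "\<lambda>_. True"])
    (auto intro: pt_const simp: encode_eq_Leaf_iff)

lemma pt_not: "pt D f \<Longrightarrow> pt D (\<lambda>x. \<not> f x)"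
  by (rule pt_cong[OF pt_if[of D f "\<lambda>_. False" "\<lambda>_. True"]]) (auto intro: pt_const)

lemma pt_conj: "pt D f \<Longrightarrow> pt {x \<in> D. f x} g \<Longrightarrow> pt D (\<lambda>x. f x \<and> g x)"
  by (rule pt_cong[OF pt_if[of D f g "\<lambda>_. False"]]) (auto intro: pt_const)

lemma pt_disj: "pt D f \<Longrightarrow> pt {x \<in> D. \<not> f x} g \<Longrightarrow> pt D (\<lambda>x. f x \<or> g x)"
  by (rule pt_cong[OF pt_if[of D f "\<lambda>_. True" g]]) (auto intro: pt_const)

lemma pt_Ball:
  assumes "pt {z. fst z \<in> D \<and> snd z \<in> set (l (fst z))} (\<lambda>z. f (fst z) (snd z))" "pt D l"
  shows "pt D (\<lambda>x. \<forall>e\<in>set (l x). f x e)"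
  by (rule pt_cong[OF pt_null[OF pt_filter[OF pt_not[OF assms(1)] assms(2)]]])
    (simp add: filter_empty_conv)

lemma pt_Bex:
  assumes "pt {z. fst z \<in> D \<and> snd z \<in> set (l (fst z))} (\<lambda>z. f (fst z) (snd z))" "pt D l"
  shows "pt D (\<lambda>x. \<exists>e\<in>set (l x). f x e)"
  using pt_not[OF pt_Ball[OF pt_not[OF assms(1)] assms(2)]] by simp

lemma pt_case_list:
  assumes "pt D l" "pt D c" "pt {x \<in> D. l x \<noteq> []} (\<lambda>x. f x (hd (l x)) (tl (l x)))"
  shows "pt D (\<lambda>x. case l x of [] \<Rightarrow> c x | y # ys \<Rightarrow> f x y ys)"
proof (rule pt_cong)
  show "pt D (\<lambda>x. if l x = [] then c x else f x (hd (l x)) (tl (l x)))"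
    using assms by (intro pt_if pt_null) (auto intro: pt_subset)
qed (auto split: list.split)

text \<open>Unary numerals and lists of units coincide as trees. Hence a number can drive a fold as
  its counter, and lists of units turn into numbers, without any computation.\<close>

lemma encode_replicate_unit: "encode (replicate n ()) = encode n"
  by (induction n) auto

lemma pt_units: "pt D f \<Longrightarrow> pt D (\<lambda>x. replicate (f x) ())"
  by (erule pt_code) (simp add: encode_replicate_unit)

lemma pt_length:
  assumes "pt D l" shows "pt D (\<lambda>x. length (l x))"
proof -
  have "pt D (\<lambda>x. map (\<lambda>_. ()) (l x))" by (intro pt_map pt_const assms)
  then show ?thesis by (rule pt_code) (simp add: map_replicate_const encode_replicate_unit)
qed

lemma pt_plus:
  assumes "pt D f" "pt D g" shows "pt D (\<lambda>x. f x + g x :: nat)"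
proof (rule pt_code)
  show "pt D (\<lambda>x. replicate (f x) () @ replicate (g x) ())" by (intro pt_append pt_units assms)
qed (simp add: encode_replicate_unit flip: replicate_add)

lemma pt_minus:
  assumes "pt D f" "pt D g" shows "pt D (\<lambda>x. f x - g x :: nat)"
proof (rule pt_app2[OF _ assms])
  have eq: "fold (\<lambda>_ m. m - 1) xs n = n - length xs" for xs :: "unit list" and n :: nat
    by (induction xs arbitrary: n) auto
  have "pt UNIV (\<lambda>z::nat \<times> nat. fold (\<lambda>_ m. m - 1) (replicate (snd z) ()) (fst z))"
    by (rule pt_fold[where B = esize])
      (intro pt_pred pt_units pt_fst pt_snd pt_id pbound_intros | auto simp only: eq; auto)+
  then show "pt UNIV (\<lambda>z::nat \<times> nat. fst z - snd z)" by (simp only: eq length_replicate)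
qed

lemma pt_le: "pt D f \<Longrightarrow> pt D g \<Longrightarrow> pt D (\<lambda>x. (f x :: nat) \<le> g x)"
  by (rule pt_cong[OF pt_eq_0[OF pt_minus[of D f g]]]) auto

lemma pt_less: "pt D f \<Longrightarrow> pt D g \<Longrightarrow> pt D (\<lambda>x. (f x :: nat) < g x)"
  using pt_not[OF pt_le[of D g f]] by (simp add: not_le)

lemma pt_eq_nat: "pt D f \<Longrightarrow> pt D g \<Longrightarrow> pt D (\<lambda>x. (f x :: nat) = g x)"
  by (rule pt_cong[OF pt_conj[OF pt_le[of D f g] pt_le[of _ g f]]]) (auto elim: pt_subset)

lemma pt_member_nat: "pt D f \<Longrightarrow> pt D l \<Longrightarrow> pt D (\<lambda>x. (f x :: nat) \<in> set (l x))"
proof (rule pt_cong)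
  assume fl: "pt D f" "pt D l"
  have "pt {z. fst z \<in> D \<and> snd z \<in> set (l (fst z))} (\<lambda>z. f (fst z))"
    by (rule pt_comp[OF fl(1)]) (auto intro: pt_fst pt_id)
  then show "pt D (\<lambda>x. \<exists>e\<in>set (l x). e = f x)"
    by (intro pt_Bex pt_eq_nat pt_snd pt_id fl)
qed auto

lemma pt_upt:
  assumes "pt D f" shows "pt D (\<lambda>x. [0..<f x])"
proof -
  have eq: "fold (\<lambda>_ acc. length acc # acc) xs [] = rev [0..<length xs]" for xs :: "unit list"
    by (induction xs rule: rev_induct) auto
  have "pt UNIV (\<lambda>n. fold (\<lambda>_ acc. length acc # acc) (replicate n ()) [])"
  proof (rule pt_fold[where B = "\<lambda>n. esize n * Suc (esize n)"])
    show "esize (fold (\<lambda>_ acc. length acc # acc) ys []) \<le> esize n * Suc (esize n)"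
      if "replicate n () = ys @ zs" for n ys zs
      using arg_cong[OF that, of length] unfolding eq esize_rev by (intro esize_list_le) auto
  qed (intro pt_Cons pt_length pt_units pt_fst pt_snd pt_id pt_const pbound_intros)+
  from pt_app1[OF pt_rev[OF this] assms] show ?thesis unfolding eq by simp
qed

lemma pt_drop:
  assumes "pt D f" "pt D l" shows "pt D (\<lambda>x. drop (f x) (l x))"
proof (rule pt_app2[OF _ assms])
  have eq: "fold (\<lambda>_ l. tl l) us l = drop (length us) l" for us :: "unit list" and l :: "'b list"
    by (induction us arbitrary: l) (auto simp: drop_Suc)
  have "pt UNIV (\<lambda>z::nat \<times> 'b list. fold (\<lambda>_ l. tl l) (replicate (fst z) ()) (snd z))"
  proof (rule pt_fold[where B = esize])
    show "esize (fold (\<lambda>_ l. tl l) ys (snd z)) \<le> esize z" for ys :: "unit list" and z :: "nat \<times> 'b list"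
      unfolding eq using esize_drop_le[of "length ys" "snd z"] by (cases z) auto
  qed (intro pt_tl pt_units pt_fst pt_snd pt_id pbound_intros)+
  then show "pt UNIV (\<lambda>z::nat \<times> 'b list. drop (fst z) (snd z))" unfolding eq by simp
qed

text \<open>Indexing with a default has a specified value beyond the end of the list, so the rule
  carries no side condition on the index.\<close>

lemma pt_nth_default:
  assumes "pt D c" "pt D l" "pt D f" shows "pt D (\<lambda>x. nth_default (c x) (l x) (f x))"
proof (rule pt_cong)
  show "pt D (\<lambda>x. case drop (f x) (l x) of [] \<Rightarrow> c x | y # ys \<Rightarrow> y)"
    by (intro pt_case_list pt_drop pt_hd pt_subset[OF pt_drop[OF assms(3,2)]] assms) auto
qed (auto simp: nth_default_def drop_eq_Nil split: list.split
      intro: hd_drop_conv_nth[symmetric] dest: arg_cong[of _ _ hd] simp flip: hd_drop_conv_nth)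

lemmas pt_intros =
  pt_id pt_const pt_fst pt_snd pt_Pair pt_if pt_Cons pt_tl pt_Suc pt_append pt_rev pt_map pt_concat
  pt_filter pt_null pt_eq_0 pt_not pt_conj pt_disj pt_Ball pt_Bex pt_case_list pt_length
  pt_plus pt_minus pt_le pt_less pt_eq_nat pt_member_nat pt_upt pt_drop pt_nth_default

section \<open>Bipartite matching\<close>

definition matching :: "(nat \<times> nat) list \<Rightarrow> (nat \<times> nat) list \<Rightarrow> bool" where
  "matching E M \<longleftrightarrow> set M \<subseteq> set E \<and> inj_on fst (set M) \<and> inj_on snd (set M)"

text \<open>
  In the search for an augmenting path from \<open>b\<close>, a configuration \<open>(x, M')\<close> records that \<open>x\<close> has been
  reached; \<open>M'\<close> is the current matching shifted along the path, so that it covers \<open>b\<close> but not \<open>x\<close>.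
\<close>

definition reroutes :: "(nat \<times> nat) list \<Rightarrow> (nat \<times> (nat \<times> nat) list) list \<Rightarrow>
    (nat \<times> (nat \<times> nat) list) list" where
  "reroutes E V = concat (map (\<lambda>c. concat (map (\<lambda>e.
     map (\<lambda>f. (fst f, e # filter (\<lambda>g. snd g \<noteq> snd e) (snd c)))
       (filter (\<lambda>f. snd f = snd e \<and> fst f \<notin> set (map fst V)) (snd c)))
     (filter (\<lambda>e. fst e = fst c) E))) V)"

text \<open>Only one configuration is added per round. All reroutes are computed relative to the
  same \<open>V\<close>, so several of them may end in the same vertex, and adding them together
  would destroy distinctness.\<close>

definition explore :: "(nat \<times> nat) list \<Rightarrow> (nat \<times> (nat \<times> nat) list) list \<Rightarrow>
    (nat \<times> (nat \<times> nat) list) list" where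
  "explore E V = (case reroutes E V of [] \<Rightarrow> V | c # _ \<Rightarrow> c # V)"

definition completions :: "(nat \<times> nat) list \<Rightarrow> (nat \<times> (nat \<times> nat) list) list \<Rightarrow>
    (nat \<times> nat) list list" where
  "completions E V = concat (map (\<lambda>c. map (\<lambda>e. e # snd c)
     (filter (\<lambda>e. fst e = fst c \<and> snd e \<notin> set (map snd (snd c))) E)) V)"

text \<open>Inside this definition \<open>ls\<close> is merely a clock: its length is the number of
  search rounds. Without a completion \<open>M\<close> is kept, and \<open>b\<close> stays
  uncovered.\<close>

definition augment :: "(nat \<times> nat) list \<Rightarrow> nat list \<Rightarrow> nat \<Rightarrow> (nat \<times> nat) list \<Rightarrow> (nat \<times> nat) list" where
  "augment E ls b M = (case completions E (fold (\<lambda>_. explore E) ls [(b, M)]) of [] \<Rightarrow> M | M' # _ \<Rightarrow> M')"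

definition max_matching :: "(nat \<times> nat) list \<Rightarrow> nat list \<Rightarrow> (nat \<times> nat) list" where
  "max_matching E ls = fold (augment E ls) ls []"

section \<open>Correctness of the augmenting search\<close>

lemma reroutes_iff:
  "c \<in> set (reroutes E V) \<longleftrightarrow> (\<exists>x M' u y. (x, M') \<in> set V \<and> (x, u) \<in> set E \<and> (y, u) \<in> set M' \<and>
     y \<notin> fst ` set V \<and> c = (y, (x, u) # filter (\<lambda>g. snd g \<noteq> u) M'))"
proof -
  have "set (reroutes E V) = (\<Union>d\<in>set V. \<Union>e\<in>{e \<in> set E. fst e = fst d}.
      (\<lambda>f. (fst f, e # filter (\<lambda>g. snd g \<noteq> snd e) (snd d))) `
      {f \<in> set (snd d). snd f = snd e \<and> fst f \<notin> fst ` set V})"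
    unfolding reroutes_def by simp
  then show ?thesis
    by (simp only: UN_iff image_iff[of c] mem_Collect_eq Bex_def split_paired_Ex fst_conv snd_conv) blast
qed

lemma completions_iff:
  "N \<in> set (completions E V) \<longleftrightarrow> (\<exists>x M' u. (x, M') \<in> set V \<and> (x, u) \<in> set E \<and> u \<notin> snd ` set M' \<and>
     N = (x, u) # M')"
proof -
  have "set (completions E V) = (\<Union>d\<in>set V.
      (\<lambda>e. e # snd d) ` {e \<in> set E. fst e = fst d \<and> snd e \<notin> snd ` set (snd d)})"
    unfolding completions_def by simp
  then show ?thesis
    by (simp only: UN_iff image_iff[of N] mem_Collect_eq Bex_def split_paired_Ex fst_conv snd_conv) blast
qed

text \<open>The last clause ties all configurations to \<open>M\<close>: shifting along a path
  changes only edges at left vertices already reached. This permits the comparison with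
  \<open>M\<close> once the search is stuck.\<close>

definition search_inv :: "(nat \<times> nat) list \<Rightarrow> (nat \<times> nat) list \<Rightarrow> nat \<Rightarrow>
    (nat \<times> (nat \<times> nat) list) list \<Rightarrow> bool" where
  "search_inv E M b V \<longleftrightarrow> distinct (map fst V) \<and> b \<in> fst ` set V \<and>
     (\<forall>x M'. (x, M') \<in> set V \<longrightarrow> matching E M' \<and> x \<in> insert b (fst ` set M) \<and>
        fst ` set M' = insert b (fst ` set M) - {x} \<and> snd ` set M' = snd ` set M \<and>
        (\<forall>y u. y \<notin> fst ` set V \<longrightarrow> (y, u) \<in> set M' \<longleftrightarrow> (y, u) \<in> set M))"

lemma search_inv_reached:
  assumes "search_inv E M b V" shows "fst ` set V \<subseteq> insert b (fst ` set M)"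
proof -
  have "x \<in> insert b (fst ` set M)" if "(x, M') \<in> set V" for x M'
    using assms that unfolding search_inv_def by blast
  then show ?thesis by force
qed

lemma search_inv_Cons:
  assumes inv: "search_inv E M b V" and c: "c \<in> set (reroutes E V)"
  shows "search_inv E M b (c # V)"
proof -
  obtain x M' u y where 1: "(x, M') \<in> set V" "(x, u) \<in> set E" "(y, u) \<in> set M'"
    "y \<notin> fst ` set V" and c: "c = (y, (x, u) # filter (\<lambda>g. snd g \<noteq> u) M')"
    using c unfolding reroutes_iff by blast
  have M': "matching E M'" "x \<in> insert b (fst ` set M)" "fst ` set M' = insert b (fst ` set M) - {x}"
    "snd ` set M' = snd ` set M" "\<And>z w. z \<notin> fst ` set V \<Longrightarrow> (z, w) \<in> set M' \<longleftrightarrow> (z, w) \<in> set M"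
    using inv 1(1) unfolding search_inv_def by blast+
  have xV: "x \<in> fst ` set V" using 1(1) by force
  then have "x \<noteq> y" using 1(4) by auto
  \<comment> \<open>\<open>y\<close> is the only partner of \<open>u\<close>, so the filter deletes
    exactly the edge (y, u), in whose place \<open>x\<close> takes over \<open>u\<close>.\<close>
  have uniq: "z = y" if "(z, u) \<in> set M'" for z
    using M'(1) that 1(3) unfolding matching_def inj_on_def by force
  let ?N = "(x, u) # filter (\<lambda>g. snd g \<noteq> u) M'"
  have "g \<in> {g \<in> set M'. snd g \<noteq> u} \<longleftrightarrow> g \<in> set M' - {(y, u)}" for g
    using uniq[of "fst g"] by (cases g) auto
  then have N: "set ?N = insert (x, u) (set M' - {(y, u)})"
    unfolding list.set set_filter by blast
  have xM': "x \<notin> fst ` set M'" using M'(3) by simp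
  have "matching E ?N"
    using M'(1) 1(2) xM' unfolding matching_def by (auto simp: inj_on_def image_iff)
  moreover have "y \<in> insert b (fst ` set M)" using 1(3) M'(3) by force
  moreover have "fst ` set ?N = insert b (fst ` set M) - {y}"
  proof -
    have "fst ` (set M' - {(y, u)}) = fst ` set M' - {y}"
      using M'(1) 1(3) unfolding matching_def by (subst inj_on_image_set_diff[of fst "set M'"]) auto
    then show ?thesis using M'(2,3) \<open>x \<noteq> y\<close> unfolding N by auto
  qed
  moreover have "snd ` set ?N = snd ` set M"
    using 1(3) unfolding M'(4)[symmetric] by (auto simp: image_iff) (metis snd_conv)+
  moreover have "(z, w) \<in> set ?N \<longleftrightarrow> (z, w) \<in> set M" if "z \<notin> fst ` set (c # V)" for z w
  proof -
    have "z \<noteq> x" "z \<noteq> y" "z \<notin> fst ` set V" using that xV c by auto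
    then show ?thesis using M'(5)[of z w] unfolding N by auto
  qed
  ultimately show ?thesis
    using inv 1(4) unfolding search_inv_def c by auto
qed

lemma search_inv_explore:
  assumes "search_inv E M b V"
  shows "search_inv E M b (explore E V)"
  using assms search_inv_Cons[OF assms] unfolding explore_def by (auto split: list.split)

text \<open>
  If the search is stuck at \<open>V\<close>, the neighbours of the vertices reached are all matched to vertices
  reached other than \<open>b\<close>, against Hall's condition.
\<close>

lemma stuck_imp_no_saturation:
  assumes inv: "search_inv E M b V" and b: "b \<notin> fst ` set M" and M: "matching E M"
    and "reroutes E V = []" "completions E V = []"
    and \<sigma>: "inj_on \<sigma> (insert b (fst ` set M))" "\<And>x. x \<in> insert b (fst ` set M) \<Longrightarrow> (x, \<sigma> x) \<in> set E"
  shows False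
proof -
  define X where "X = fst ` set V"
  have X: "X \<subseteq> insert b (fst ` set M)" "finite X" "b \<in> X"
    using inv search_inv_reached[OF inv] unfolding search_inv_def X_def by simp_all
  let ?F = "{e \<in> set M. fst e \<in> X}"
  have "\<sigma> ` X \<subseteq> snd ` ?F"
  proof
    fix u assume "u \<in> \<sigma> ` X"
    then obtain x M' where x: "(x, M') \<in> set V" "u = \<sigma> x" unfolding X_def by force
    have "x \<in> X" using x(1) unfolding X_def by (rule image_eqI[rotated]) simp
    then have e: "(x, u) \<in> set E" using \<sigma>(2)[of x] X(1) unfolding x(2) by blast
    have M': "matching E M'" "snd ` set M' = snd ` set M"
      "\<And>z w. z \<notin> X \<Longrightarrow> (z, w) \<in> set M' \<longleftrightarrow> (z, w) \<in> set M"
      using inv x(1) unfolding search_inv_def X_def by blast+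
    have u: "u \<in> snd ` set M'"
    proof (rule ccontr)
      assume "u \<notin> snd ` set M'"
      then have "(x, u) # M' \<in> set (completions E V)" using x(1) e unfolding completions_iff by blast
      then show False using assms(5) by simp
    qed
    then obtain y where y: "(y, u) \<in> set M'" by force
    have "y \<in> X"
    proof (rule ccontr)
      assume "y \<notin> X"
      then have "\<exists>c. c \<in> set (reroutes E V)" using x(1) e y unfolding reroutes_iff X_def by blast
      then show False using assms(4) by simp
    qed
    \<comment> \<open>The count below is about \<open>M\<close>, while \<open>y\<close> is a partner
      in \<open>M'\<close>. A partner in \<open>M\<close> outside \<open>X\<close> would be one in
      \<open>M'\<close> as well, where \<open>u\<close> has the single partner \<open>y\<close> in
      \<open>X\<close>.\<close>
    obtain y' where y': "(y', u) \<in> set M" using u unfolding M'(2) by force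
    have "y' \<in> X"
    proof (rule ccontr)
      assume "y' \<notin> X"
      then have "(y', u) \<in> set M'" using M'(3) y' by blast
      then have "y' = y" using y M'(1) unfolding matching_def inj_on_def by force
      then show False using \<open>y \<in> X\<close> \<open>y' \<notin> X\<close> by simp
    qed
    then show "u \<in> snd ` ?F" using y' by force
  qed
  then have "card (\<sigma> ` X) \<le> card ?F"
    by (rule surj_card_le[rotated]) simp
  also have "card ?F = card (fst ` ?F)"
    using M inj_on_subset[of fst "set M" ?F] unfolding matching_def
    by (intro card_image[symmetric]) blast
  also have "\<dots> \<le> card (X - {b})" using b X(2) by (intro card_mono) auto
  also have "\<dots> < card X" using X(2,3) by (rule card_Diff1_less)
  finally show False using card_image[OF inj_on_subset[OF \<sigma>(1) X(1)]] by simp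
qed

text \<open>Every round that is not stuck reaches a new left vertex, and all of these lie in
  \<open>ls\<close>. If \<open>length ls\<close> rounds left the search unfinished, one further
  round would exhibit more distinct vertices than \<open>ls\<close> has entries.\<close>

lemma reroutes_eventually_empty:
  assumes "search_inv E M b V" "insert b (fst ` set M) \<subseteq> set ls"
  shows "reroutes E (fold (\<lambda>_. explore E) ls V) = []"
proof (rule ccontr)
  let ?f = "\<lambda>n. (explore E ^^ n) V"
  have eq: "fold (\<lambda>_. explore E) ks W = (explore E ^^ length ks) W" for ks :: "nat list" and W
    by (induction ks arbitrary: W) (auto simp: funpow_swap1)
  assume stuck: "reroutes E (fold (\<lambda>_. explore E) ls V) \<noteq> []"
  have stable: "?f n = ?f m" if "reroutes E (?f m) = []" "m \<le> n" for m n
  proof -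
    have "explore E (?f m) = ?f m" using that(1) by (simp add: explore_def)
    with that(2) show ?thesis by (induction n rule: dec_induct) simp_all
  qed
  have ne: "reroutes E (?f m) \<noteq> []" if "m \<le> length ls" for m
    using stable[OF _ that] stuck unfolding eq by metis
  have inv: "search_inv E M b (?f n)" for n
    by (induction n) (auto intro: assms search_inv_explore)
  have "length V + n = length (?f n)" if "n \<le> Suc (length ls)" for n
    using that
  proof (induction n)
    case (Suc n)
    have "length (explore E W) = Suc (length W)" if "reroutes E W \<noteq> []" for W
      using that unfolding explore_def by (cases "reroutes E W") simp_all
    then show ?case using Suc ne[of n] by simp
  qed simp
  from this[of "Suc (length ls)"] have "length ls < length (?f (Suc (length ls)))" by simp
  also have "\<dots> = card (fst ` set (?f (Suc (length ls))))"
    using inv[of "Suc (length ls)"] unfolding search_inv_def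
    by (metis distinct_card length_map set_map)
  also have "\<dots> \<le> card (set ls)"
    using search_inv_reached[OF inv] assms(2) by (intro card_mono finite_set) (rule subset_trans)
  also have "\<dots> \<le> length ls" by (rule card_length)
  finally show False by simp
qed

lemma search_inv_fold_explore:
  "search_inv E M b V \<Longrightarrow> search_inv E M b (fold (\<lambda>_. explore E) ls V)"
  by (induction ls arbitrary: V) (auto intro: search_inv_explore)

lemma search_inv_init:
  "matching E M \<Longrightarrow> b \<notin> fst ` set M \<Longrightarrow> search_inv E M b [(b, M)]"
  unfolding search_inv_def by auto

lemma matching_completion:
  assumes inv: "search_inv E M b V" and N: "N \<in> set (completions E V)"
  shows "matching E N" "fst ` set N = insert b (fst ` set M)"
proof -
  obtain x M' u where x: "(x, M') \<in> set V" "(x, u) \<in> set E" "u \<notin> snd ` set M'" "N = (x, u) # M'"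
    using N unfolding completions_iff by blast
  have M': "matching E M'" "x \<in> insert b (fst ` set M)" "fst ` set M' = insert b (fst ` set M) - {x}"
    using inv x(1) unfolding search_inv_def by blast+
  have "x \<notin> fst ` set M'" using M'(3) by simp
  then show "matching E N" using M'(1) x unfolding matching_def by (auto simp: inj_on_def image_iff)
  show "fst ` set N = insert b (fst ` set M)" using M'(2,3) x(4) by auto
qed

text \<open>The outcome has to be a matching whether or not saturation is possible: in the
  correctness proof the classes picked by the outer matching need not be those used by the plan at
  hand.\<close>

lemma matching_augment:
  assumes "matching E M" "b \<notin> fst ` set M"
  shows "matching E (augment E ls b M) \<and> fst ` set (augment E ls b M) \<subseteq> insert b (fst ` set M)"
proof (cases "completions E (fold (\<lambda>_. explore E) ls [(b, M)])")
  case Nil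
  then show ?thesis using assms(1) unfolding augment_def by auto
next
  case (Cons N Ns)
  then show ?thesis
    using matching_completion[OF search_inv_fold_explore[OF search_inv_init[OF assms]], of N ls]
    unfolding augment_def by simp
qed

lemma dom_augment:
  assumes M: "matching E M" and b: "b \<notin> fst ` set M" and ls: "insert b (fst ` set M) \<subseteq> set ls"
    and \<sigma>: "inj_on \<sigma> (set ls)" "\<And>x. x \<in> set ls \<Longrightarrow> (x, \<sigma> x) \<in> set E"
  shows "fst ` set (augment E ls b M) = insert b (fst ` set M)"
proof -
  note inv0 = search_inv_init[OF M b] and inv = search_inv_fold_explore[OF search_inv_init[OF M b], of ls]
  let ?V = "fold (\<lambda>_. explore E) ls [(b, M)]"
  have "completions E ?V \<noteq> []"
    using stuck_imp_no_saturation[OF inv b M reroutes_eventually_empty[OF inv0 ls], of \<sigma>]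
      \<sigma> ls inj_on_subset by blast
  then obtain N Ns where N: "completions E ?V = N # Ns" by (cases "completions E ?V") auto
  then show ?thesis using matching_completion(2)[OF inv, of N] unfolding augment_def by simp
qed

lemma matching_max_matching:
  assumes "distinct ls" shows "matching E (max_matching E ls)"
proof -
  have "matching E (fold (augment E ls) ks M)"
    if "matching E M" "distinct ks" "set ks \<inter> fst ` set M = {}" for ks M
    using that
  proof (induction ks arbitrary: M)
    case (Cons b ks)
    have "matching E (augment E ls b M) \<and> fst ` set (augment E ls b M) \<subseteq> insert b (fst ` set M)"
      using Cons.prems by (intro matching_augment) auto
    then show ?case using Cons.IH[of "augment E ls b M"] Cons.prems by auto
  qed simp
  from this[of "[]" ls] show ?thesis using assms unfolding max_matching_def matching_def by auto
qed

text \<open>Each augmentation adds precisely the next vertex to those covered: the restriction of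
  \<open>\<sigma>\<close> saturates the vertices treated so far together with the next one, so the
  search for it cannot fail.\<close>

theorem dom_max_matching:
  assumes "distinct ls" and \<sigma>: "inj_on \<sigma> (set ls)" "\<And>x. x \<in> set ls \<Longrightarrow> (x, \<sigma> x) \<in> set E"
  shows "fst ` set (max_matching E ls) = set ls"
proof -
  have "fst ` set (fold (augment E ls) ks M) = fst ` set M \<union> set ks"
    if "matching E M" "fst ` set M \<union> set ks \<subseteq> set ls" "distinct ks" "set ks \<inter> fst ` set M = {}" for ks M
    using that
  proof (induction ks arbitrary: M)
    case (Cons b ks)
    have "matching E (augment E ls b M)" "fst ` set (augment E ls b M) = insert b (fst ` set M)"
      using Cons.prems matching_augment[of E M b ls] dom_augment[OF _ _ _ \<sigma>, of M b] by auto
    then show ?case using Cons.IH[of "augment E ls b M"] Cons.prems by auto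
  qed simp
  from this[of "[]" ls] show ?thesis using assms(1) unfolding max_matching_def matching_def by auto
qed

section \<open>Size bounds and running time of the matching algorithm\<close>

text \<open>Entries and length are tracked separately: the search preserves both bounds, and an
  augmentation raises only the length, by one. This keeps the intermediate values of the nested
  folds polynomial.\<close>

definition bounded_pairs :: "nat \<Rightarrow> nat \<Rightarrow> (nat \<times> nat) list \<Rightarrow> bool" where
  "bounded_pairs A m M \<longleftrightarrow> length M \<le> m \<and> (\<forall>p q. (p, q) \<in> set M \<longrightarrow> p \<le> A \<and> q \<le> A)"

definition bounded_configs :: "nat \<Rightarrow> nat \<Rightarrow> (nat \<times> (nat \<times> nat) list) list \<Rightarrow> bool" where
  "bounded_configs A m V \<longleftrightarrow> (\<forall>x M. (x, M) \<in> set V \<longrightarrow> x \<le> A \<and> bounded_pairs A m M)"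

lemma bounded_pairs_self: "esize E \<le> A \<Longrightarrow> esize E \<le> m \<Longrightarrow> bounded_pairs A m E"
  unfolding bounded_pairs_def
  using length_le_esize[of E] by (auto dest!: esize_member_less)

lemma esize_bounded_pairs: "bounded_pairs A m M \<Longrightarrow> esize M \<le> m * (2 * A + 2)"
  unfolding bounded_pairs_def using esize_list_le[of M "2 * A + 1" m] by fastforce

lemma bounded_configs_explore:
  assumes E: "bounded_pairs A n E" and V: "bounded_configs A m V"
  shows "bounded_configs A m (explore E V)" "length (explore E V) \<le> Suc (length V)"
proof -
  have "bounded_configs A m (c # V)" if c: "c \<in> set (reroutes E V)" for c
  proof -
    obtain x M' u y where 1: "(x, M') \<in> set V" "(x, u) \<in> set E" "(y, u) \<in> set M'"
      and c: "c = (y, (x, u) # filter (\<lambda>g. snd g \<noteq> u) M')"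
      using c unfolding reroutes_iff by blast
    \<comment> \<open>At least (y, u) is removed, which makes room for the new edge (x, u).\<close>
    have "length (filter (\<lambda>g. snd g \<noteq> u) M') < length M'"
      by (rule length_filter_less[OF 1(3)]) simp
    moreover have M': "x \<le> A" "length M' \<le> m" "\<forall>p q. (p, q) \<in> set M' \<longrightarrow> p \<le> A \<and> q \<le> A"
      using V 1(1) unfolding bounded_configs_def bounded_pairs_def by blast+
    moreover have "u \<le> A" using E 1(2) unfolding bounded_pairs_def by blast
    ultimately have "bounded_pairs A m ((x, u) # filter (\<lambda>g. snd g \<noteq> u) M')" "y \<le> A"
      using 1(3) unfolding bounded_pairs_def by auto
    then show ?thesis using V unfolding c bounded_configs_def by auto
  qed
  then show "bounded_configs A m (explore E V)" "length (explore E V) \<le> Suc (length V)"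
    using V unfolding explore_def by (auto split: list.split)
qed

lemma bounded_configs_fold_explore:
  assumes "bounded_pairs A n E" "bounded_configs A m V"
  shows "bounded_configs A m (fold (\<lambda>_. explore E) ls V)"
    "length (fold (\<lambda>_. explore E) ls V) \<le> length V + length ls"
  using assms(2)
proof (induction ls arbitrary: V)
  case (Cons l ls)
  { case 1 then show ?case using Cons.IH bounded_configs_explore[OF assms(1)] by simp }
  { case 2 then show ?case
      using Cons.IH(2)[of "explore E V"] bounded_configs_explore[OF assms(1), of m V] by simp }
qed simp_all

lemma bounded_pairs_augment:
  assumes E: "bounded_pairs A n E" and "b \<le> A" "bounded_pairs A m M"
  shows "bounded_pairs A (Suc m) (augment E ls b M)"
proof -
  let ?V = "fold (\<lambda>_. explore E) ls [(b, M)]"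
  have V: "bounded_configs A m ?V"
    by (rule bounded_configs_fold_explore[OF E]) (use assms in \<open>simp add: bounded_configs_def\<close>)
  have "bounded_pairs A (Suc m) N" if "N \<in> set (completions E ?V)" for N
    using that V E unfolding completions_iff bounded_configs_def bounded_pairs_def by fastforce
  moreover have "bounded_pairs A (Suc m) M" using assms(3) unfolding bounded_pairs_def by auto
  ultimately show ?thesis unfolding augment_def by (auto split: list.split)
qed

lemma pt_explore: "pt D f \<Longrightarrow> pt D g \<Longrightarrow> pt D (\<lambda>x. explore (f x) (g x))"
  by (rule pt_app2) (unfold explore_def reroutes_def, intro pt_intros pt_hd, auto)

lemma pt_completions: "pt D f \<Longrightarrow> pt D g \<Longrightarrow> pt D (\<lambda>x. completions (f x) (g x))"
  by (rule pt_app2) (unfold completions_def, intro pt_intros)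

lemma pt_augment:
  assumes "pt D E" "pt D ls" "pt D b" "pt D M"
  shows "pt D (\<lambda>x. augment (E x) (ls x) (b x) (M x))"
proof (rule pt_app4[OF _ assms])
  let ?T = "UNIV :: ((nat \<times> nat) list \<times> nat list \<times> nat \<times> (nat \<times> nat) list) set"
  have "pt ?T (\<lambda>z. fold (\<lambda>_. explore (fst z)) (fst (snd z)) [(fst (snd (snd z)), snd (snd (snd z)))])"
  \<comment> \<open>There is the initial configuration and at most one more per round. Each is a
    number up to \<open>esize z\<close> paired with at most \<open>esize z\<close> edges, an edge
    having size at most 2 * \<open>esize z\<close> + 1.\<close>
  proof (rule pt_fold[where B = "\<lambda>z. (1 + esize z) * Suc (Suc (esize z + esize z * (2 * esize z + 2)))"])
    fix z :: "(nat \<times> nat) list \<times> nat list \<times> nat \<times> (nat \<times> nat) list" and ys zs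
    assume l: "fst (snd z) = ys @ zs"
    obtain E ls b M where z: "z = (E, ls, b, M)" by (cases z)
    let ?A = "esize z" and ?V = "fold (\<lambda>_. explore E) ys [(b, M)]"
    have E: "bounded_pairs ?A ?A E" and M: "bounded_pairs ?A ?A M"
      by (auto intro!: bounded_pairs_self simp: z)
    have "bounded_configs ?A ?A [(b, M)]" using M by (simp add: bounded_configs_def z)
    note V = bounded_configs_fold_explore[OF E this, of ys]
    have "esize ?V \<le> (1 + ?A) * Suc (Suc (?A + ?A * (2 * ?A + 2)))"
    proof (rule esize_list_le)
      show "length ?V \<le> 1 + ?A"
        using V(2) length_le_esize[of ys] l unfolding z by (simp add: esize_append)
      show "esize c \<le> Suc (?A + ?A * (2 * ?A + 2))" if "c \<in> set ?V" for c
      proof (cases c)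
        case (Pair x N)
        then have "x \<le> ?A" "bounded_pairs ?A ?A N" using V(1) that unfolding bounded_configs_def by auto
        then show ?thesis using esize_bounded_pairs[of ?A ?A N] Pair by simp
      qed
    qed
    then show "esize (fold (\<lambda>_. explore (fst z)) ys [(fst (snd (snd z)), snd (snd (snd z)))])
        \<le> (1 + ?A) * Suc (Suc (?A + ?A * (2 * ?A + 2)))" by (simp add: z)
  qed (intro pt_explore pt_intros pbound_intros)+
  from pt_completions[OF pt_fst[OF pt_id] this]
  show "pt ?T (\<lambda>z. augment (fst z) (fst (snd z)) (fst (snd (snd z))) (snd (snd (snd z))))"
    unfolding augment_def by (intro pt_intros pt_hd) (auto elim: pt_subset)
qed

lemma pt_max_matching:
  assumes "pt D E" "pt D ls" shows "pt D (\<lambda>x. max_matching (E x) (ls x))"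
  unfolding max_matching_def
proof (rule pt_app2[where g = "\<lambda>E ls. fold (augment E ls) ls []", OF _ assms])
  show "pt UNIV (\<lambda>z::(nat \<times> nat) list \<times> nat list. fold (augment (fst z) (snd z)) (snd z) [])"
  proof (rule pt_fold[where B = "\<lambda>z. esize z * (2 * esize z + 2)"])
    fix z :: "(nat \<times> nat) list \<times> nat list" and ys zs
    assume l: "snd z = ys @ zs"
    let ?A = "esize z"
    have E: "bounded_pairs ?A ?A (fst z)" by (cases z) (auto intro!: bounded_pairs_self)
    have mem: "b \<le> ?A" if "b \<in> set ys" for b
      using esize_member_less[of b "snd z"] that l by (cases z) auto
    have "bounded_pairs ?A (length ks + m) (fold (augment (fst z) (snd z)) ks M)"
      if "set ks \<subseteq> set ys" "bounded_pairs ?A m M" for ks m M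
      using that
    proof (induction ks arbitrary: m M)
      case (Cons b ks)
      then have "bounded_pairs ?A (Suc m) (augment (fst z) (snd z) b M)"
        using mem by (intro bounded_pairs_augment[OF E]) auto
      from Cons.IH[OF _ this] Cons.prems show ?case by simp
    qed simp
    from this[of ys 0 "[]"] have "esize (fold (augment (fst z) (snd z)) ys []) \<le> length ys * (2 * ?A + 2)"
      by (intro esize_bounded_pairs) (simp add: bounded_pairs_def)
    also have "\<dots> \<le> ?A * (2 * ?A + 2)"
      using length_le_esize[of ys] l by (intro mult_le_mono1) (cases z, simp add: esize_append)
    finally show "esize (fold (augment (fst z) (snd z)) ys []) \<le> ?A * (2 * ?A + 2)" .
  qed (intro pt_augment pt_intros pbound_intros)+
qed

section \<open>Plans with prescribed partitions\<close>

text \<open>Plans with equal kernels give a bijection only between the classes that they use, while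
  class independence speaks of permutations of all classes. By finiteness the two complements are
  equally large, so the bijection extends.\<close>

lemma extend_bij_betw:
  assumes "finite A" "P \<subseteq> A" "Q \<subseteq> A" "bij_betw f P Q"
  shows "\<exists>\<phi>. bij_betw \<phi> A A \<and> (\<forall>x\<in>P. \<phi> x = f x)"
proof -
  have fin: "finite P" "finite Q" using assms finite_subset by blast+
  have "card (A - P) = card (A - Q)"
    using assms bij_betw_same_card[OF assms(4)] fin by (simp add: card_Diff_subset)
  then obtain g where g: "bij_betw g (A - P) (A - Q)"
    using finite_same_card_bij assms(1) by blast
  let ?\<phi> = "\<lambda>x. if x \<in> P then f x else g x"
  have "bij_betw ?\<phi> P Q" using assms(4) by (rule bij_betw_cong[THEN iffD1, rotated]) simp
  moreover have "bij_betw ?\<phi> (A - P) (A - Q)" using g by (rule bij_betw_cong[THEN iffD1, rotated]) simp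
  ultimately have "bij_betw ?\<phi> (P \<union> (A - P)) (Q \<union> (A - Q))" by (rule bij_betw_combine) auto
  moreover have "P \<union> (A - P) = A" "Q \<union> (A - Q) = A" using assms by auto
  ultimately show ?thesis by (intro exI[of _ ?\<phi>]) simp
qed

text \<open>
  Plans that induce the same partition of the steps into classes differ by a permutation of the
  classes, so they satisfy the same class-independent constraints.
\<close>

lemma satisfies_same_class_kernel:
  assumes U: "finite U" "equiv U r" and ci: "class_independent U r (T, \<Theta>)" and "T \<subseteq> S"
    and \<pi>: "\<And>s. s \<in> S \<Longrightarrow> \<pi> s \<in> U" and \<rho>: "\<And>s. s \<in> S \<Longrightarrow> \<rho> s \<in> U"
    and kernel: "\<And>s t. s \<in> S \<Longrightarrow> t \<in> S \<Longrightarrow> (\<rho> s, \<rho> t) \<in> r \<longleftrightarrow> (\<pi> s, \<pi> t) \<in> r"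
    and sat: "restrict \<pi> T \<in> \<Theta>"
  shows "restrict \<rho> T \<in> \<Theta>"
proof -
  let ?p = "\<lambda>s. r `` {\<pi> s}" and ?q = "\<lambda>s. r `` {\<rho> s}"
  have eq: "?q s = ?q t \<longleftrightarrow> ?p s = ?p t" if "s \<in> T" "t \<in> T" for s t
    using that \<open>T \<subseteq> S\<close> kernel[of s t] \<pi> \<rho> by (simp add: eq_equiv_class_iff[OF U(2)] subset_iff)
  define f where "f P = ?q (SOME s. s \<in> T \<and> ?p s = P)" for P
  have f: "f (?p s) = ?q s" if "s \<in> T" for s
  proof -
    have "(SOME t. t \<in> T \<and> ?p t = ?p s) \<in> T \<and> ?p (SOME t. t \<in> T \<and> ?p t = ?p s) = ?p s"
      by (rule someI[of _ s]) (use that in simp)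
    then show ?thesis unfolding f_def using eq that by blast
  qed
  have bij: "bij_betw f (?p ` T) (?q ` T)"
    unfolding bij_betw_def inj_on_def using f eq by (auto simp: image_image)
  have sub: "?p ` T \<subseteq> U // r" "?q ` T \<subseteq> U // r"
    using \<open>T \<subseteq> S\<close> \<pi> \<rho> by (auto intro: quotientI)
  have "finite (U // r)" using U by (simp add: equiv_def finite_quotient)
  then obtain \<phi> where \<phi>: "bij_betw \<phi> (U // r) (U // r)" "\<forall>P\<in>?p ` T. \<phi> P = f P"
    using extend_bij_betw[OF _ sub bij] by blast
  have *: "compose T \<phi> (class_fun r T (restrict \<pi> T)) = class_fun r T (restrict \<rho> T)"
    unfolding compose_def class_fun_def using \<phi>(2) f by (intro restrict_ext) simp
  have U': "restrict \<pi> T \<in> T \<rightarrow>\<^sub>E U" "restrict \<rho> T \<in> T \<rightarrow>\<^sub>E U"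
    using \<open>T \<subseteq> S\<close> \<pi> \<rho> by auto
  \<comment> \<open>Clause (2) of class independence yields the class function of
    \<open>\<rho>\<close>; clause (1) then returns from it to \<open>\<rho>\<close> itself.\<close>
  have "compose T \<phi> (class_fun r T (restrict \<pi> T)) \<in> class_fun r T ` \<Theta>"
    using ci \<phi>(1) U'(1) imageI[OF sat, of "class_fun r T"] unfolding class_independent_def by blast
  then show ?thesis using ci U'(2) unfolding * class_independent_def by blast
qed

text \<open>User independence is class independence for the identity relation, whose kernel records
  which steps share a user. So one argument serves both kinds of constraint, with the relation
  chosen per constraint.\<close>

lemma eligible_same_kernels:
  assumes W: "wf_workflow W" and r: "equiv (users W) r"
    and C: "\<And>c. c \<in> constraints W \<Longrightarrow> user_independent (users W) c \<or> class_independent (users W) r c"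
    and \<pi>: "\<And>s. s \<in> steps W \<Longrightarrow> \<pi> s \<in> users W" and \<rho>: "\<And>s. s \<in> steps W \<Longrightarrow> \<rho> s \<in> users W"
    and "\<And>s t. s \<in> steps W \<Longrightarrow> t \<in> steps W \<Longrightarrow> \<rho> s = \<rho> t \<longleftrightarrow> \<pi> s = \<pi> t"
    and "\<And>s t. s \<in> steps W \<Longrightarrow> t \<in> steps W \<Longrightarrow> (\<rho> s, \<rho> t) \<in> r \<longleftrightarrow> (\<pi> s, \<pi> t) \<in> r"
    and "eligible W \<pi>"
  shows "eligible W \<rho>"
  unfolding eligible_def
proof
  fix c assume c: "c \<in> constraints W"
  obtain T \<Theta> where T: "c = (T, \<Theta>)" by (cases c)
  have fin: "finite (users W)" and "T \<subseteq> steps W"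
    using W c unfolding T wf_workflow_def wf_constraint_def by auto
  have sat: "restrict \<pi> T \<in> \<Theta>" using assms(8) c unfolding T eligible_def satisfies_def by auto
  have "equiv (users W) (Id_on (users W))" by (auto simp: equiv_def refl_on_def sym_def trans_def)
  have "restrict \<rho> T \<in> \<Theta>"
    using C[OF c] unfolding T user_independent_def
  proof
    assume ci: "class_independent (users W) (Id_on (users W)) (T, \<Theta>)"
    show ?thesis
      by (rule satisfies_same_class_kernel[OF fin \<open>equiv (users W) (Id_on (users W))\<close> ci
            \<open>T \<subseteq> steps W\<close> \<pi> \<rho> _ sat]) (simp_all add: Id_on_iff \<pi> \<rho> assms(6))
  next
    assume ci: "class_independent (users W) r (T, \<Theta>)"
    show ?thesis
      by (rule satisfies_same_class_kernel[OF fin r ci \<open>T \<subseteq> steps W\<close> \<pi> \<rho> _ sat])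
        (simp_all add: assms(7))
  qed
  then show "satisfies \<rho> c" unfolding T satisfies_def by simp
qed

text \<open>
  A vector \<open>v\<close> of \<open>k\<close> digits below \<open>2 * k\<close> describes how a plan identifies steps. If digit \<open>s\<close> is
  below \<open>k\<close>, then \<open>s\<close> represents its user, and the digit is the representative of the class of that
  user; otherwise the digit is \<open>k\<close> plus the step representing the user of \<open>s\<close>.
\<close>

definition holder :: "nat \<Rightarrow> nat list \<Rightarrow> nat \<Rightarrow> nat" where
  "holder k v s = (if nth_default 0 v s < k then s else nth_default 0 v s - k)"

text \<open>A group of steps sharing a user is named by its representative, a set of steps sharing a
  class by a label \<open>a\<close>. The list gives the groups inside the set labelled
  \<open>a\<close>.\<close>

definition holders :: "nat \<Rightarrow> nat list \<Rightarrow> nat \<Rightarrow> nat list" where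
  "holders k v a = filter (\<lambda>p. p \<in> set (map (holder k v) [0..<k]) \<and> nth_default 0 v p = a) [0..<k]"

text \<open>\<open>A\<close> and \<open>R\<close> list, for each user, the authorized steps and the
  class of that user; a class is passed as one of its members \<open>c\<close>. Authorization is
  demanded for all steps held by \<open>p\<close>, as they will get the same user.\<close>

definition user_edges :: "nat \<Rightarrow> nat list list \<Rightarrow> nat list list \<Rightarrow> nat list \<Rightarrow> nat \<Rightarrow> nat \<Rightarrow> (nat \<times> nat) list"
  where
  "user_edges k A R v a c = concat (map (\<lambda>p. map (\<lambda>u. (p, u))
     (filter (\<lambda>u. \<forall>s\<in>set [0..<k]. holder k v s \<noteq> p \<or> s \<in> set (nth_default [] A u)) (nth_default [] R c)))
     (holders k v a))"

definition user_matching :: "nat \<Rightarrow> nat list list \<Rightarrow> nat list list \<Rightarrow> nat list \<Rightarrow> nat \<Rightarrow> nat \<Rightarrow> (nat \<times> nat) list"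
  where
  "user_matching k A R v a c = max_matching (user_edges k A R v a c) (holders k v a)"

definition colours :: "nat \<Rightarrow> nat list \<Rightarrow> nat list" where
  "colours k v = filter (\<lambda>a. holders k v a \<noteq> []) [0..<k]"

text \<open>Least members make each class occur once. Otherwise the outer matching could give the
  same class to two labels under different names.\<close>

definition class_reps :: "nat \<Rightarrow> nat list list \<Rightarrow> nat list" where
  "class_reps n R = filter (\<lambda>c. \<forall>u\<in>set (nth_default [] R c). c \<le> u) [0..<n]"

definition class_edges :: "nat \<Rightarrow> nat \<Rightarrow> nat list list \<Rightarrow> nat list list \<Rightarrow> nat list \<Rightarrow> (nat \<times> nat) list"
  where
  "class_edges k n A R v = concat (map (\<lambda>a. map (\<lambda>c. (a, c))
     (filter (\<lambda>c. \<forall>p\<in>set (holders k v a). p \<in> set (map fst (user_matching k A R v a c))) (class_reps n R)))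
     (colours k v))"

definition class_matching :: "nat \<Rightarrow> nat \<Rightarrow> nat list list \<Rightarrow> nat list list \<Rightarrow> nat list \<Rightarrow> (nat \<times> nat) list"
  where
  "class_matching k n A R v = max_matching (class_edges k n A R v) (colours k v)"

text \<open>The default 0 makes the function total for vectors whose groups cannot all be matched;
  the later verification of the candidate decides whether the resulting list is a plan.\<close>

definition partner :: "(nat \<times> nat) list \<Rightarrow> nat \<Rightarrow> nat" where
  "partner M p = (case filter (\<lambda>e. fst e = p) M of [] \<Rightarrow> 0 | e # _ \<Rightarrow> snd e)"

definition chosen_user :: "nat \<Rightarrow> nat \<Rightarrow> nat list list \<Rightarrow> nat list list \<Rightarrow> nat list \<Rightarrow> nat \<Rightarrow> nat" where
  "chosen_user k n A R v p =
     partner (user_matching k A R v (nth_default 0 v p)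
       (partner (class_matching k n A R v) (nth_default 0 v p))) p"

definition candidate :: "nat \<Rightarrow> nat \<Rightarrow> nat list list \<Rightarrow> nat list list \<Rightarrow> nat list \<Rightarrow> nat list" where
  "candidate k n A R v = map (\<lambda>s. chosen_user k n A R v (holder k v s)) [0..<k]"

section \<open>Polynomial time of the candidate construction\<close>

lemma pt_app6:
  "pt UNIV (\<lambda>z. g (fst z) (fst (snd z)) (fst (snd (snd z))) (fst (snd (snd (snd z))))
      (fst (snd (snd (snd (snd z))))) (snd (snd (snd (snd (snd z)))))) \<Longrightarrow>
    pt D a \<Longrightarrow> pt D b \<Longrightarrow> pt D c \<Longrightarrow> pt D d \<Longrightarrow> pt D e \<Longrightarrow> pt D f \<Longrightarrow>
    pt D (\<lambda>x. g (a x) (b x) (c x) (d x) (e x) (f x))"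
  using pt_app5[OF _ _ _ _ _ pt_Pair, of "\<lambda>x y u w z. g x y u w (fst z) (snd z)" D a b c d e f]
  by simp

lemma pt_holder:
  "pt D k \<Longrightarrow> pt D v \<Longrightarrow> pt D s \<Longrightarrow> pt D (\<lambda>x. holder (k x) (v x) (s x))"
  by (rule pt_app3) (unfold holder_def, intro pt_intros)

lemma pt_holders:
  "pt D k \<Longrightarrow> pt D v \<Longrightarrow> pt D a \<Longrightarrow> pt D (\<lambda>x. holders (k x) (v x) (a x))"
  by (rule pt_app3) (unfold holders_def, intro pt_holder pt_intros)

lemma pt_user_edges:
  "pt D k \<Longrightarrow> pt D A \<Longrightarrow> pt D R \<Longrightarrow> pt D v \<Longrightarrow> pt D a \<Longrightarrow> pt D c \<Longrightarrow>
    pt D (\<lambda>x. user_edges (k x) (A x) (R x) (v x) (a x) (c x))"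
  by (rule pt_app6) (unfold user_edges_def, intro pt_holder pt_holders pt_intros)

lemma pt_user_matching:
  "pt D k \<Longrightarrow> pt D A \<Longrightarrow> pt D R \<Longrightarrow> pt D v \<Longrightarrow> pt D a \<Longrightarrow> pt D c \<Longrightarrow>
    pt D (\<lambda>x. user_matching (k x) (A x) (R x) (v x) (a x) (c x))"
  unfolding user_matching_def by (intro pt_max_matching pt_user_edges pt_holders)

lemma pt_colours: "pt D k \<Longrightarrow> pt D v \<Longrightarrow> pt D (\<lambda>x. colours (k x) (v x))"
  by (rule pt_app2) (unfold colours_def, intro pt_holders pt_intros)

lemma pt_class_reps: "pt D n \<Longrightarrow> pt D R \<Longrightarrow> pt D (\<lambda>x. class_reps (n x) (R x))"
  by (rule pt_app2) (unfold class_reps_def, intro pt_intros)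

lemma pt_class_edges:
  "pt D k \<Longrightarrow> pt D n \<Longrightarrow> pt D A \<Longrightarrow> pt D R \<Longrightarrow> pt D v \<Longrightarrow>
    pt D (\<lambda>x. class_edges (k x) (n x) (A x) (R x) (v x))"
  by (rule pt_app5)
    (unfold class_edges_def, intro pt_holders pt_user_matching pt_class_reps pt_colours pt_intros)

lemma pt_class_matching:
  "pt D k \<Longrightarrow> pt D n \<Longrightarrow> pt D A \<Longrightarrow> pt D R \<Longrightarrow> pt D v \<Longrightarrow>
    pt D (\<lambda>x. class_matching (k x) (n x) (A x) (R x) (v x))"
  unfolding class_matching_def by (intro pt_max_matching pt_class_edges pt_colours)

lemma pt_partner: "pt D M \<Longrightarrow> pt D p \<Longrightarrow> pt D (\<lambda>x. partner (M x) (p x))"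
  by (rule pt_app2) (unfold partner_def, intro pt_intros pt_hd, auto)

lemma pt_chosen_user:
  "pt D k \<Longrightarrow> pt D n \<Longrightarrow> pt D A \<Longrightarrow> pt D R \<Longrightarrow> pt D v \<Longrightarrow> pt D p \<Longrightarrow>
    pt D (\<lambda>x. chosen_user (k x) (n x) (A x) (R x) (v x) (p x))"
  unfolding chosen_user_def
  by (intro pt_partner pt_user_matching pt_class_matching pt_nth_default pt_const)

lemma pt_candidate:
  "pt D k \<Longrightarrow> pt D n \<Longrightarrow> pt D A \<Longrightarrow> pt D R \<Longrightarrow> pt D v \<Longrightarrow>
    pt D (\<lambda>x. candidate (k x) (n x) (A x) (R x) (v x))"
  by (rule pt_app5) (unfold candidate_def, intro pt_chosen_user pt_holder pt_intros)

section \<open>Completeness of the candidates\<close>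

lemma mem_concat_map_Pair:
  "(p, u) \<in> set (concat (map (\<lambda>p. map (\<lambda>u. (p, u)) (f p)) ps)) \<longleftrightarrow> p \<in> set ps \<and> u \<in> set (f p)"
  by auto

lemma partner_mem: "p \<in> fst ` set M \<Longrightarrow> (p, partner M p) \<in> set M"
proof -
  assume "p \<in> fst ` set M"
  then obtain e es where e: "filter (\<lambda>e. fst e = p) M = e # es"
    by (cases "filter (\<lambda>e. fst e = p) M") (auto simp: filter_empty_conv)
  then have "e \<in> {e \<in> set M. fst e = p}" by (metis list.set_intros(1) set_filter)
  then show ?thesis unfolding partner_def e by (cases e) simp
qed

text \<open>Its code is literally the tree \<open>enc_auth\<close>, just as that of
  \<open>rel_lists\<close> is \<open>enc_rel\<close>, so the program finds these lists ready in its
  input.\<close>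

definition auth_lists :: "nat \<Rightarrow> nat \<Rightarrow> (nat \<Rightarrow> nat set) \<Rightarrow> nat list list" where
  "auth_lists k n au = map (\<lambda>u. filter (\<lambda>s. s \<in> au u) [0..<k]) [0..<n]"

definition rel_lists :: "nat \<Rightarrow> (nat \<times> nat) set \<Rightarrow> nat list list" where
  "rel_lists n r = map (\<lambda>u. filter (\<lambda>v. (u, v) \<in> r) [0..<n]) [0..<n]"

lemma set_auth_lists: "s \<in> set (nth_default [] (auth_lists k n au) u) \<longleftrightarrow> u < n \<and> s < k \<and> s \<in> au u"
  unfolding auth_lists_def nth_default_def by auto

lemma set_rel_lists: "v \<in> set (nth_default [] (rel_lists n r) u) \<longleftrightarrow> u < n \<and> v < n \<and> (u, v) \<in> r"
  unfolding rel_lists_def nth_default_def by auto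

text \<open>For the vector describing \<open>\<pi>\<close>, the plan \<open>\<pi>\<close> itself
  witnesses that both levels of matching can be saturated, hence the computed matchings are
  saturating. They may choose other classes and users than \<open>\<pi>\<close>, but injectivity at
  the two levels preserves both kernels.\<close>

lemma ex_candidate:
  fixes \<pi> :: "nat \<Rightarrow> nat"
  assumes r: "equiv {..<n} r" and \<pi>: "\<And>s. s < k \<Longrightarrow> \<pi> s < n" "\<And>s. s < k \<Longrightarrow> s \<in> au (\<pi> s)"
  shows "\<exists>v. length v = k \<and> set v \<subseteq> {..<2 * k} \<and>
    (let \<rho> = candidate k n (auth_lists k n au) (rel_lists n r) v in
      (\<forall>s<k. \<rho> ! s < n \<and> s \<in> au (\<rho> ! s)) \<and>
      (\<forall>s<k. \<forall>t<k. \<rho> ! s = \<rho> ! t \<longleftrightarrow> \<pi> s = \<pi> t) \<and>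
      (\<forall>s<k. \<forall>t<k. (\<rho> ! s, \<rho> ! t) \<in> r \<longleftrightarrow> (\<pi> s, \<pi> t) \<in> r))"
proof -
  let ?A = "auth_lists k n au" and ?R = "rel_lists n r"
  have refl: "(u, u) \<in> r" if "u < n" for u
    using r that unfolding equiv_def refl_on_def by auto
  have sym: "(u, w) \<in> r \<Longrightarrow> (w, u) \<in> r" for u w
    using r unfolding equiv_def by (blast dest: symD)
  have trans: "(u, w) \<in> r \<Longrightarrow> (w, x) \<in> r \<Longrightarrow> (u, x) \<in> r" for u w x
    using r unfolding equiv_def by (blast dest: transD)
  have dom: "u < n \<and> w < n" if "(u, w) \<in> r" for u w
    using r that unfolding equiv_def refl_on_def by auto
  \<comment> \<open>The minima range over all naturals, but \<open>s\<close> qualifies for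
    \<open>lead s\<close>, and for \<open>cl s\<close> if \<open>s\<close> is a step; so for steps
    both values are at most \<open>s\<close> and are steps again.\<close>
  define lead where "lead s = (LEAST t. \<pi> t = \<pi> s)" for s
  define cl where "cl s = (LEAST t. (\<pi> t, \<pi> s) \<in> r)" for s
  define rep where "rep u = (LEAST w. (w, u) \<in> r)" for u
  have lead_le: "lead s \<le> s" for s unfolding lead_def by (rule Least_le) simp
  have \<pi>_lead: "\<pi> (lead s) = \<pi> s" for s unfolding lead_def by (rule LeastI[of _ s]) simp
  have lead_eq: "lead s = lead t \<longleftrightarrow> \<pi> s = \<pi> t" for s t
    using \<pi>_lead[of s] \<pi>_lead[of t] unfolding lead_def by metis
  have cl_le: "cl s \<le> s" if "s < k" for s unfolding cl_def by (rule Least_le) (use that \<pi> refl in auto)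
  have \<pi>_cl: "(\<pi> (cl s), \<pi> s) \<in> r" if "s < k" for s
    unfolding cl_def by (rule LeastI[of _ s]) (use that \<pi> refl in auto)
  have cl_eq: "cl s = cl t \<longleftrightarrow> (\<pi> s, \<pi> t) \<in> r" if "s < k" "t < k" for s t
  proof
    assume "(\<pi> s, \<pi> t) \<in> r"
    then have "(\<pi> w, \<pi> s) \<in> r \<longleftrightarrow> (\<pi> w, \<pi> t) \<in> r" for w using sym trans by blast
    then show "cl s = cl t" unfolding cl_def by simp
  qed (use \<pi>_cl[OF that(1)] \<pi>_cl[OF that(2)] sym trans in metis)
  have rep: "(rep u, u) \<in> r" if "u < n" for u
    unfolding rep_def by (rule LeastI[of _ u]) (use that refl in auto)
  have rep_least: "rep u \<le> w" if "(w, u) \<in> r" for u w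
    unfolding rep_def by (rule Least_le) (rule that)
  define v where "v = map (\<lambda>s. if lead s = s then cl s else k + lead s) [0..<k]"
  have v_nth: "nth_default 0 v s = (if lead s = s then cl s else k + lead s)" if "s < k" for s
    using that unfolding v_def nth_default_def by simp
  have holder: "holder k v s = lead s" if "s < k" for s
    using that cl_le[OF that] v_nth[OF that] unfolding holder_def by auto
  have holders: "set (holders k v a) = {p. p < k \<and> lead p = p \<and> cl p = a}" for a
  proof -
    have "p \<in> lead ` {0..<k} \<and> nth_default 0 v p = a \<longleftrightarrow> lead p = p \<and> cl p = a" if "p < k" for p
    proof -
      have "p \<in> lead ` {0..<k} \<longleftrightarrow> lead p = p"
        using that \<pi>_lead lead_eq by (auto simp: image_iff) (metis atLeast0LessThan lessThan_iff)
      then show ?thesis using v_nth[OF that] by auto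
    qed
    moreover have "holder k v ` {0..<k} = lead ` {0..<k}" using holder by (intro image_cong) auto
    ultimately show ?thesis unfolding holders_def by auto
  qed
  have dist: "distinct (holders k v a)" "distinct (colours k v)" for a
    unfolding holders_def colours_def by simp_all
  have colours: "a \<in> set (colours k v) \<longleftrightarrow> (\<exists>p<k. lead p = p \<and> cl p = a)" for a
  proof -
    have "holders k v a \<noteq> [] \<longleftrightarrow> set (holders k v a) \<noteq> {}" by simp
    also have "\<dots> \<longleftrightarrow> (\<exists>p<k. lead p = p \<and> cl p = a)" unfolding holders by blast
    finally show ?thesis unfolding colours_def using cl_le by fastforce
  qed
  have user_edges: "(p, u) \<in> set (user_edges k ?A ?R v a c) \<longleftrightarrow> p \<in> set (holders k v a) \<and>
      (c, u) \<in> r \<and> (\<forall>s<k. lead s = p \<longrightarrow> s \<in> au u)" for p u a c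
    unfolding user_edges_def mem_concat_map_Pair using holder dom[of c u]
    by (auto simp: set_auth_lists set_rel_lists)
  have reps: "c \<in> set (class_reps n ?R) \<longleftrightarrow> c < n \<and> (\<forall>u. (c, u) \<in> r \<longrightarrow> c \<le> u)" for c
    unfolding class_reps_def using dom by (auto simp: set_rel_lists)
  have class_edges: "(a, c) \<in> set (class_edges k n ?A ?R v) \<longleftrightarrow> a \<in> set (colours k v) \<and>
      c \<in> set (class_reps n ?R) \<and> set (holders k v a) \<subseteq> fst ` set (user_matching k ?A ?R v a c)" for a c
    unfolding class_edges_def by auto
  \<comment> \<open>Each label is sent to the class that \<open>\<pi>\<close> uses for it; inside
    that class, \<open>\<pi>\<close> on the representatives is the required saturating
    assignment.\<close>
  have sat: "(a, rep (\<pi> a)) \<in> set (class_edges k n ?A ?R v)" if a: "a \<in> set (colours k v)" for a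
  proof -
    obtain p where p: "p < k" "cl p = a" using a colours by blast
    then have "a < k" using cl_le by fastforce
    note rep_a = rep[OF \<pi>(1)[OF this]]
    have "rep (\<pi> a) \<in> set (class_reps n ?R)"
      unfolding reps using dom[OF rep_a] rep_least sym trans rep_a by blast
    moreover have "fst ` set (user_matching k ?A ?R v a (rep (\<pi> a))) = set (holders k v a)"
      unfolding user_matching_def
    proof (rule dom_max_matching[OF dist(1)])
      show "inj_on \<pi> (set (holders k v a))"
      proof (rule inj_onI)
        fix p q assume pq: "p \<in> set (holders k v a)" "q \<in> set (holders k v a)" "\<pi> p = \<pi> q"
        then have "lead p = p" "lead q = q" unfolding holders by auto
        then show "p = q" using lead_eq[of p q] pq(3) by simp
      qed
      show "(q, \<pi> q) \<in> set (user_edges k ?A ?R v a (rep (\<pi> a)))" if q: "q \<in> set (holders k v a)" for q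
      proof -
        have q': "q < k" "lead q = q" "cl q = a" using q unfolding holders by auto
        have "(rep (\<pi> a), \<pi> q) \<in> r" using rep_a \<pi>_cl[OF q'(1)] trans q'(3) by blast
        moreover have "s \<in> au (\<pi> q)" if "s < k" "lead s = q" for s
          using \<pi>(2)[OF that(1)] lead_eq[of s q] that(2) q'(2) by simp
        ultimately show ?thesis unfolding user_edges using q by blast
      qed
    qed
    ultimately show ?thesis unfolding class_edges using a by blast
  qed
  \<comment> \<open>Labels are least steps of their class, so two labels with the same class
    coincide.\<close>
  have "inj_on (\<lambda>a. rep (\<pi> a)) (set (colours k v))"
  proof (rule inj_onI)
    fix a b assume ab: "a \<in> set (colours k v)" "b \<in> set (colours k v)" "rep (\<pi> a) = rep (\<pi> b)"
    obtain p q where p: "p < k" "cl p = a" and q: "q < k" "cl q = b"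
      using ab(1,2) unfolding colours by blast
    then have "a < k" "b < k" using cl_le by fastforce+
    then have "(\<pi> a, \<pi> b) \<in> r" using rep[OF \<pi>(1), of a] rep[OF \<pi>(1), of b] ab(3) sym trans by metis
    then have "(\<pi> p, \<pi> q) \<in> r"
      using \<pi>_cl[OF p(1)] \<pi>_cl[OF q(1)] sym trans unfolding p(2) q(2) by blast
    then show "a = b" using cl_eq[OF p(1) q(1)] p(2) q(2) by simp
  qed
  from dom_max_matching[OF dist(2) this sat]
  have dom_C: "fst ` set (class_matching k n ?A ?R v) = set (colours k v)"
    unfolding class_matching_def .
  have C: "matching (class_edges k n ?A ?R v) (class_matching k n ?A ?R v)"
    unfolding class_matching_def by (rule matching_max_matching[OF dist(2)])
  define cc where "cc a = partner (class_matching k n ?A ?R v) a" for a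
  define \<rho> where "\<rho> s = partner (user_matching k ?A ?R v (cl s) (cc (cl s))) (lead s)" for s
  have cc_mem: "(cl s, cc (cl s)) \<in> set (class_matching k n ?A ?R v)"
    and hold: "lead s \<in> set (holders k v (cl s))" if "s < k" for s
  proof -
    have l: "lead s < k" using lead_le[of s] that by simp
    have "cl (lead s) = cl s" using cl_eq[OF l that] \<pi>_lead refl \<pi>(1)[OF that] by simp
    then show "lead s \<in> set (holders k v (cl s))"
      unfolding holders using l lead_eq \<pi>_lead by simp
    then have "cl s \<in> set (colours k v)" unfolding colours holders by blast
    then show "(cl s, cc (cl s)) \<in> set (class_matching k n ?A ?R v)"
      unfolding cc_def using dom_C by (intro partner_mem) simp
  qed
  have cc_edge: "(cl s, cc (cl s)) \<in> set (class_edges k n ?A ?R v)" if "s < k" for s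
    using cc_mem[OF that] C unfolding matching_def by blast
  have U: "matching (user_edges k ?A ?R v a c) (user_matching k ?A ?R v a c)" for a c
    unfolding user_matching_def by (rule matching_max_matching[OF dist(1)])
  \<comment> \<open>The inner matching covers every holder even in a class chosen by the algorithm,
    since covering them is the condition for an edge of the outer graph.\<close>
  have \<rho>_mem: "(lead s, \<rho> s) \<in> set (user_matching k ?A ?R v (cl s) (cc (cl s)))" if "s < k" for s
    unfolding \<rho>_def using cc_edge[OF that] hold[OF that] unfolding class_edges
    by (intro partner_mem) blast
  have \<rho>_edge: "(lead s, \<rho> s) \<in> set (user_edges k ?A ?R v (cl s) (cc (cl s)))" if "s < k" for s
    using \<rho>_mem[OF that] U unfolding matching_def by blast
  have \<rho>_class: "(cc (cl s), \<rho> s) \<in> r" and \<rho>_auth: "s \<in> au (\<rho> s)" if "s < k" for s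
    using \<rho>_edge[OF that] that unfolding user_edges by auto
  \<comment> \<open>Related class representatives are equal, each being the least of its class;
    injectivity of the outer matching on the right then identifies the labels.\<close>
  have \<rho>_rel: "(\<rho> s, \<rho> t) \<in> r \<longleftrightarrow> (\<pi> s, \<pi> t) \<in> r" if st: "s < k" "t < k" for s t
  proof
    assume "(\<rho> s, \<rho> t) \<in> r"
    then have "(cc (cl s), cc (cl t)) \<in> r" "(cc (cl t), cc (cl s)) \<in> r"
      using \<rho>_class[OF st(1)] \<rho>_class[OF st(2)] sym trans by blast+
    then have "cc (cl s) = cc (cl t)"
      using cc_edge[OF st(1)] cc_edge[OF st(2)] unfolding class_edges reps by force
    then have "cl s = cl t"
      using cc_mem[OF st(1)] cc_mem[OF st(2)] C unfolding matching_def inj_on_def by force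
    then show "(\<pi> s, \<pi> t) \<in> r" using cl_eq[OF st] by simp
  next
    assume "(\<pi> s, \<pi> t) \<in> r"
    then have "cl s = cl t" using cl_eq[OF st] by simp
    then show "(\<rho> s, \<rho> t) \<in> r" using \<rho>_class[OF st(1)] \<rho>_class[OF st(2)] sym trans by metis
  qed
  \<comment> \<open>A shared user forces a shared class, hence one and the same inner matching,
    whose injectivity on the right identifies the representatives.\<close>
  have \<rho>_eq: "\<rho> s = \<rho> t \<longleftrightarrow> \<pi> s = \<pi> t" if st: "s < k" "t < k" for s t
  proof
    assume eq: "\<rho> s = \<rho> t"
    then have "(\<rho> s, \<rho> t) \<in> r" using dom[OF \<rho>_class[OF st(1)]] refl by simp
    then have "cl s = cl t" using \<rho>_rel[OF st] cl_eq[OF st] by simp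
    then have "lead s = lead t"
      using \<rho>_mem[OF st(1)] \<rho>_mem[OF st(2)] U eq unfolding matching_def inj_on_def by force
    then show "\<pi> s = \<pi> t" using lead_eq by simp
  next
    assume "\<pi> s = \<pi> t"
    then have "lead s = lead t" "cl s = cl t" using lead_eq unfolding cl_def by simp_all
    then show "\<rho> s = \<rho> t" unfolding \<rho>_def by simp
  qed
  have cand: "candidate k n ?A ?R v ! s = \<rho> s" if "s < k" for s
  proof -
    have l: "lead s < k" using lead_le[of s] that by simp
    have "nth_default 0 v (lead s) = cl s"
      using hold[OF that] v_nth[OF l] unfolding holders by simp
    then show ?thesis
      using that unfolding candidate_def chosen_user_def \<rho>_def cc_def by (simp add: holder)
  qed
  have digit: "(if lead s = s then cl s else k + lead s) < 2 * k" if "s < k" for s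
    using cl_le[OF that] lead_le[of s] that by simp
  have "set v \<subseteq> {..<2 * k}"
  proof
    fix x assume "x \<in> set v"
    then obtain s where "s < k" "x = (if lead s = s then cl s else k + lead s)"
      unfolding v_def by force
    then show "x \<in> {..<2 * k}" using digit by simp
  qed
  moreover have "length v = k" unfolding v_def by simp
  moreover have "\<rho> s < n" if "s < k" for s using dom[OF \<rho>_class[OF that]] by blast
  ultimately show ?thesis
    unfolding Let_def using cand \<rho>_auth \<rho>_eq \<rho>_rel by (intro exI[of _ v]) simp
qed

section \<open>The search over all partitions\<close>

text \<open>Least significant digit first and of fixed length, so that carrying is a single fold
  from left to right. For k = 0 there is one vector, the empty one, in accordance with 0^0 =
  1.\<close>

fun digits :: "nat \<Rightarrow> nat \<Rightarrow> nat \<Rightarrow> nat list" where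
  "digits B 0 i = []"
| "digits B (Suc k) i = (i mod B) # digits B k (i div B)"

definition inc_digit :: "nat \<Rightarrow> nat \<Rightarrow> bool \<times> nat list \<Rightarrow> bool \<times> nat list" where
  "inc_digit B d acc =
     (if fst acc then if Suc d < B then (False, snd acc @ [Suc d]) else (True, snd acc @ [0])
      else (False, snd acc @ [d]))"

definition increment :: "nat \<Rightarrow> nat list \<Rightarrow> bool \<times> nat list" where
  "increment B v = fold (inc_digit B) v (True, [])"

lemma inc_digit_simps:
  "inc_digit B d (True, out) = (if Suc d < B then (False, out @ [Suc d]) else (True, out @ [0]))"
  "inc_digit B d (False, out) = (False, out @ [d])"
  unfolding inc_digit_def by simp_all

lemma fold_inc_digit_False: "fold (inc_digit B) v (False, out) = (False, out @ v)"
  by (induction v arbitrary: out) (auto simp: inc_digit_simps)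

text \<open>The final carry is the termination signal of the search. If the lowest digit does not
  overflow, \<open>B\<close> does not divide i + 1, so i + 1 is no positive power of
  \<open>B\<close>; otherwise a factor \<open>B\<close> cancels and the induction hypothesis applies
  to \<open>i div B\<close>.\<close>

lemma fold_inc_digit_True:
  "i < B ^ k \<Longrightarrow>
    fold (inc_digit B) (digits B k i) (True, out) = (Suc i = B ^ k, out @ digits B k (Suc i))"
proof (induction k arbitrary: i out)
  case (Suc k)
  then have B: "B > 0" by (cases B) auto
  have i: "i div B < B ^ k" using Suc.prems by (simp add: less_mult_imp_div_less mult.commute)
  show ?case
  proof (cases "Suc (i mod B) < B")
    case True
    then have *: "Suc i mod B = Suc (i mod B)" "Suc i div B = i div B"
      by (auto simp: mod_Suc div_Suc)
    then have "Suc i \<noteq> B ^ Suc k" by (metis mod_mult_self1_is_0 nat.distinct(1) power_Suc)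
    then show ?thesis using * True by (simp add: inc_digit_simps fold_inc_digit_False)
  next
    case False
    then have "Suc (i mod B) = B" using B by (simp add: Suc_leI le_antisym not_less)
    then have *: "Suc i mod B = 0" "Suc i div B = Suc (i div B)" by (auto simp: mod_Suc div_Suc)
    then have "Suc i = B * Suc (i div B)" by (metis add.right_neutral mult_div_mod_eq)
    then have "Suc i = B ^ Suc k \<longleftrightarrow> B * Suc (i div B) = B * B ^ k" by (simp only: power_Suc)
    also have "\<dots> \<longleftrightarrow> Suc (i div B) = B ^ k" using B by (simp only: mult_cancel1) simp
    finally have "Suc i = B ^ Suc k \<longleftrightarrow> Suc (i div B) = B ^ k" .
    then show ?thesis using * False Suc.IH[OF i] by (simp add: inc_digit_simps)
  qed
qed simp

lemma increment_digits:
  "i < B ^ k \<Longrightarrow> increment B (digits B k i) = (Suc i = B ^ k, digits B k (Suc i))"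
  unfolding increment_def by (simp add: fold_inc_digit_True)

lemma length_digits [simp]: "length (digits B k i) = k"
  by (induction k arbitrary: i) auto

lemma digits_less: "B > 0 \<Longrightarrow> d \<in> set (digits B k i) \<Longrightarrow> d < B"
  by (induction k arbitrary: i) auto

lemma digits_0: "digits B k 0 = replicate k 0"
  by (induction k) auto

lemma ex_digits: "set v \<subseteq> {..<B} \<Longrightarrow> \<exists>i<B ^ length v. digits B (length v) i = v"
proof (induction v)
  case (Cons d v)
  then obtain i where i: "i < B ^ length v" "digits B (length v) i = v" by auto
  have "d < B" using Cons.prems by simp
  then have "d + B * i < B ^ length (d # v)"
  proof -
    have "d + B * i < B * Suc i" using \<open>d < B\<close> by simp
    also have "\<dots> \<le> B * B ^ length v" using i(1) by (intro mult_le_mono2) simp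
    finally show ?thesis by simp
  qed
  moreover have "digits B (length (d # v)) (d + B * i) = d # v"
    using i(2) \<open>d < B\<close> by simp
  ultimately show ?case by blast
qed simp

lemma pt_increment: "pt D B \<Longrightarrow> pt D v \<Longrightarrow> pt D (\<lambda>x. increment (B x) (v x))"
proof (rule pt_app2[where g = increment])
  have le: "esize (fold (inc_digit B) v acc) \<le> 2 + esize (snd acc) + 2 * esize v" for B v acc
  proof (induction v arbitrary: acc)
    case Nil
    then show ?case by (cases acc; cases "fst acc") auto
  next
    case (Cons d v)
    have "esize (snd (inc_digit B d acc)) \<le> esize (snd acc) + (d + 2)"
      unfolding inc_digit_def by (auto simp: esize_append)
    then show ?case using Cons.IH[of "inc_digit B d acc"] by simp
  qed
  show "pt UNIV (\<lambda>z. increment (fst z) (snd z))"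
    unfolding increment_def
  proof (rule pt_fold[where B = "\<lambda>z. 2 + 2 * esize z"])
    show "esize (fold (inc_digit (fst z)) ys (True, [])) \<le> 2 + 2 * esize z"
      if "snd z = ys @ zs" for z ys zs
      using le[of "fst z" ys "(True, [])"] arg_cong[OF that, of esize]
      by (cases z) (simp add: esize_append)
  qed ((unfold inc_digit_def)?, intro pt_intros pbound_intros)+
qed

section \<open>Typed inputs and queries, and the constraint checker\<close>

lemma pbound_poly: "pbound D f \<Longrightarrow> pbound D (\<lambda>x. poly q (f x) :: nat)"
  by (induction q) (auto intro!: pbound_intros)

text \<open>A nested tuple ending in a unit has the code of a list of the codes of its components,
  the unit being the final \<open>Leaf\<close>. This turns the prescribed encodings into codes of
  typed values.\<close>

type_synonym wsp_input = "nat \<times> nat \<times> nat list list \<times> nat list list \<times> tree list \<times> unit"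

type_synonym wsp_query = "nat \<times> nat \<times> nat list list \<times> tree \<times> nat list \<times> unit"

type_synonym search_state = "wsp_input \<times> nat list \<times> bool \<times> bool"

definition query :: "wsp_instance \<Rightarrow> tree \<Rightarrow> (nat \<Rightarrow> nat) \<Rightarrow> wsp_query" where
  "query I d \<pi> = (num_steps I, num_users I, rel_lists (num_users I) (user_equiv I), d,
     map \<pi> [0..<num_steps I], ())"

definition input :: "wsp_instance \<Rightarrow> wsp_input" where
  "input I = (num_steps I, num_users I, auth_lists (num_steps I) (num_users I) (auths I),
     rel_lists (num_users I) (user_equiv I), descriptions I, ())"

lemma encode_nat_lists: "encode (map (\<lambda>x. f x :: nat list) xs) = enc_list (map (\<lambda>x. enc_list (map enc_nat (f x))) xs)"
  by (simp add: encode_list_def encode_nat_def[abs_def] o_def)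

lemma encode_query: "encode (query I d \<pi>) = enc_query I d \<pi>"
  unfolding query_def enc_query_def rel_lists_def enc_rel_def enc_plan_def
  by (simp add: encode_nat_lists)
    (simp add: encode_nat_def[abs_def] encode_tree_def encode_list_def o_def)

lemma encode_input: "encode (input I) = enc_instance I"
  unfolding input_def enc_instance_def rel_lists_def enc_rel_def auth_lists_def enc_auth_def
  by (simp add: encode_nat_lists)
    (simp add: encode_nat_def[abs_def] encode_tree_def[abs_def] encode_list_def)

definition valid_query :: "constraint_language \<Rightarrow> wsp_instance \<Rightarrow> tree \<Rightarrow> (nat \<Rightarrow> nat) \<Rightarrow> bool" where
  "valid_query L I d \<pi> \<longleftrightarrow> ui_ci_instance L I \<and> d \<in> set (descriptions I) \<and> \<pi> \<in> plans (workflow_of L I)"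

definition queries :: "constraint_language \<Rightarrow> wsp_query set" where
  "queries L = {query I d \<pi> | I d \<pi>. valid_query L I d \<pi>}"

text \<open>The existential makes this a function of the query alone, as \<open>pt\<close> demands;
  \<open>sat_query\<close> shows that the instance chosen behind a query is immaterial.\<close>

definition sat :: "constraint_language \<Rightarrow> wsp_query \<Rightarrow> bool" where
  "sat L z \<longleftrightarrow> (\<exists>I d \<pi>. valid_query L I d \<pi> \<and> z = query I d \<pi> \<and> satisfies \<pi> (constraint_of L I d))"

lemma ui_ci_instanceD:
  assumes "ui_ci_instance L I"
  shows "equiv {..<num_users I} (user_equiv I)" "wf_workflow (workflow_of L I)"
    "c \<in> constraints (workflow_of L I) \<Longrightarrow> user_independent {..<num_users I} c \<or>
      class_independent {..<num_users I} (user_equiv I) c"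
  using assms unfolding ui_ci_instance_def workflow_of_def by (auto simp: Let_def)

text \<open>The numbers, the relation and the description in a query determine the constraint, and
  the list determines the plan. The relation is recovered from its lists because it relates only
  users, and the plan because plans are extensional.\<close>

lemma sat_query:
  assumes q: "valid_query L I d \<pi>"
  shows "sat L (query I d \<pi>) \<longleftrightarrow> satisfies \<pi> (constraint_of L I d)"
proof -
  have "satisfies \<pi> (constraint_of L I d)"
    if q': "valid_query L I' d' \<pi>'" and eq: "query I d \<pi> = query I' d' \<pi>'"
      and s: "satisfies \<pi>' (constraint_of L I' d')" for I' d' \<pi>'
  proof -
    have k: "num_steps I' = num_steps I" and n: "num_users I' = num_users I" and d: "d' = d"
      and r: "rel_lists (num_users I) (user_equiv I) = rel_lists (num_users I) (user_equiv I')"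
      and \<pi>: "map \<pi> [0..<num_steps I] = map \<pi>' [0..<num_steps I]"
      using eq unfolding query_def by auto
    have sub: "user_equiv I \<subseteq> {..<num_users I} \<times> {..<num_users I}"
      "user_equiv I' \<subseteq> {..<num_users I} \<times> {..<num_users I}"
      using q q' ui_ci_instanceD(1)[of L I] ui_ci_instanceD(1)[of L I'] n
      unfolding valid_query_def equiv_def refl_on_def by auto
    have "(u, v) \<in> user_equiv I \<longleftrightarrow> (u, v) \<in> user_equiv I'" for u v
      using set_rel_lists[of v "num_users I" "user_equiv I" u]
        set_rel_lists[of v "num_users I" "user_equiv I'" u] r sub by auto
    then have "user_equiv I = user_equiv I'" by auto
    then have "constraint_of L I' d' = constraint_of L I d" unfolding constraint_of_def using k n d by simp
    moreover have "\<pi> = \<pi>'"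
    proof (rule PiE_ext)
      show "\<pi> \<in> {..<num_steps I} \<rightarrow>\<^sub>E {..<num_users I}" "\<pi>' \<in> {..<num_steps I} \<rightarrow>\<^sub>E {..<num_users I}"
        using q q' k n unfolding valid_query_def plans_def workflow_of_def by auto
      show "\<pi> s = \<pi>' s" if "s \<in> {..<num_steps I}" for s
        using \<pi> that by (auto simp: map_eq_conv)
    qed
    ultimately show ?thesis using s by simp
  qed
  then show ?thesis unfolding sat_def using q by blast
qed

lemma pt_sat:
  assumes "poly_time_checkable L"
  shows "pt (queries L) (sat L)"
proof -
  obtain P q where P: "\<And>I d \<pi>. ui_ci_instance L I \<Longrightarrow> d \<in> set (descriptions I) \<Longrightarrow>
      \<pi> \<in> plans (workflow_of L I) \<Longrightarrow>
      decides_within P (enc_query I d \<pi>) (satisfies \<pi> (constraint_of L I d)) (real (poly q (num_users I)))"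
    using assms unfolding poly_time_checkable_def by blast
  \<comment> \<open>The checker may say yes with any tree other than \<open>Leaf\<close>; this
    converts its answer to the code of a boolean.\<close>
  let ?B = "cond_com (Assign 0 (Var 0)) (Assign 0 (NodeE LeafE LeafE)) (Assign 0 LeafE)"
  obtain b where B: "computes_in ?B y b (encode (y \<noteq> Leaf))" for y
  proof (rule that)
    fix y
    show "computes_in ?B y (2 + 4 + (3 * com_bound (Assign 0 (Var 0)) +
      3 * com_bound (Assign 0 (NodeE LeafE LeafE)) + 3 * com_bound (Assign 0 LeafE) + 20)) (encode (y \<noteq> Leaf))"
    proof (rule computes_in_cond)
      show "computes_in (Assign 0 (Var 0)) y 2 y" using computes_in_mono[OF computes_in_expr[of "Var 0" y], of 2] by simp
      show "computes_in (Assign 0 (NodeE LeafE LeafE)) y 4 (encode (y \<noteq> Leaf))" if "y \<noteq> Leaf"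
        using computes_in_mono[OF computes_in_expr[of "NodeE LeafE LeafE" y], of 4] that by simp
      show "computes_in (Assign 0 LeafE) y 4 (encode (y \<noteq> Leaf))" if "y = Leaf"
        using computes_in_mono[OF computes_in_expr[of LeafE y], of 4] that by simp
    qed
  qed
  show ?thesis
  proof (rule ptI[where P = "Seq P (call 0 ?B)" and
        T = "\<lambda>z. poly q (fst (snd z)) + b + (3 * com_bound ?B + 3)"])
    show "pbound (queries L) (\<lambda>z. esize (sat L z))"
      by (rule pbound_mono[OF pbound_const[of _ 1]]) (auto simp: encode_bool_def)
    \<comment> \<open>The number of users is part of the query in unary, so a polynomial in it is
      bounded by one in the size of the query.\<close>
    show "pbound (queries L) (\<lambda>z. poly q (fst (snd z)) + b + (3 * com_bound ?B + 3))"
      by (intro pbound_add pbound_const pbound_poly pbound_mono[OF pbound_esize]) auto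
    fix z assume "z \<in> queries L"
    then obtain I d \<pi> where z: "z = query I d \<pi>" "valid_query L I d \<pi>" unfolding queries_def by blast
    have "decides_within P (encode z) (sat L z) (real (poly q (fst (snd z))))"
      using P[of I d \<pi>] z(2) sat_query[OF z(2)] unfolding z(1) encode_query
      by (simp add: valid_query_def query_def)
    then obtain y where "computes_in P (encode z) (poly q (fst (snd z))) y" "y \<noteq> Leaf \<longleftrightarrow> sat L z"
      unfolding decides_within_def computes_in_def by auto
    from computes_in_comp[OF this(1) B[of y]] this(2)
    show "computes_in (Seq P (call 0 ?B)) (encode z)
      (poly q (fst (snd z)) + b + (3 * com_bound ?B + 3)) (encode (sat L z))" by simp
  qed
qed

definition plan_ok :: "nat \<Rightarrow> nat \<Rightarrow> nat list list \<Rightarrow> nat list \<Rightarrow> bool" where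
  "plan_ok k n A \<rho> \<longleftrightarrow>
     (\<forall>s\<in>set [0..<k]. nth_default 0 \<rho> s < n \<and> s \<in> set (nth_default [] A (nth_default 0 \<rho> s)))"

text \<open>The order of the conjunction matters: the checker is consulted only after
  \<open>plan_ok\<close> has succeeded, when the query lies in the domain for which its running time
  is guaranteed.\<close>

definition accepts :: "constraint_language \<Rightarrow> wsp_input \<Rightarrow> nat list \<Rightarrow> bool" where
  "accepts L x v = (case x of (k, n, A, R, ds, u) \<Rightarrow>
     plan_ok k n A (candidate k n A R v) \<and> (\<forall>d\<in>set ds. sat L (k, n, R, d, candidate k n A R v, u)))"

lemma pt_plan_ok:
  "pt D k \<Longrightarrow> pt D n \<Longrightarrow> pt D A \<Longrightarrow> pt D \<rho> \<Longrightarrow> pt D (\<lambda>x. plan_ok (k x) (n x) (A x) (\<rho> x))"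
  by (rule pt_app4) (unfold plan_ok_def, intro pt_intros)

lemma plan_okD:
  assumes len: "length \<rho> = num_steps I"
    and ok: "plan_ok (num_steps I) (num_users I) (auth_lists (num_steps I) (num_users I) (auths I)) \<rho>"
  defines "\<pi> \<equiv> restrict (nth \<rho>) {..<num_steps I}"
  shows "\<pi> \<in> plans (workflow_of L I)" "authorized (workflow_of L I) \<pi>"
    "query I d \<pi> = (num_steps I, num_users I, rel_lists (num_users I) (user_equiv I), d, \<rho>, ())"
proof -
  have "\<rho> ! s < num_users I \<and> s \<in> auths I (\<rho> ! s)" if "s < num_steps I" for s
    using ok nth_default_nth[of s \<rho> 0] len that unfolding plan_ok_def by (force simp: set_auth_lists)
  then show "\<pi> \<in> plans (workflow_of L I)" "authorized (workflow_of L I) \<pi>"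
    unfolding plans_def authorized_def workflow_of_def \<pi>_def by auto
  have "map \<pi> [0..<num_steps I] = \<rho>"
    unfolding \<pi>_def by (rule nth_equalityI) (use len in auto)
  then show "query I d \<pi> = (num_steps I, num_users I, rel_lists (num_users I) (user_equiv I), d, \<rho>, ())"
    unfolding query_def by simp
qed

lemma length_candidate [simp]: "length (candidate k n A R v) = k"
  unfolding candidate_def by simp

lemma plan_ok_valid_query:
  assumes "ui_ci_instance L I" "d \<in> set (descriptions I)" "length \<rho> = num_steps I"
    "plan_ok (num_steps I) (num_users I) (auth_lists (num_steps I) (num_users I) (auths I)) \<rho>"
  shows "valid_query L I d (restrict (nth \<rho>) {..<num_steps I})"
  using assms plan_okD(1)[OF assms(3,4)] unfolding valid_query_def by blast

lemma plan_ok_mem_queries: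
  assumes "ui_ci_instance L I" "d \<in> set (descriptions I)" "length \<rho> = num_steps I"
    "plan_ok (num_steps I) (num_users I) (auth_lists (num_steps I) (num_users I) (auths I)) \<rho>"
  shows "(num_steps I, num_users I, rel_lists (num_users I) (user_equiv I), d, \<rho>, ()) \<in> queries L"
  using plan_ok_valid_query[OF assms] plan_okD(3)[OF assms(3,4), of d] unfolding queries_def by force

lemma pt_accepts:
  assumes "poly_time_checkable L" "pt D f" "pt D g"
    "\<And>z. z \<in> D \<Longrightarrow> \<exists>I. ui_ci_instance L I \<and> f z = input I"
  shows "pt D (\<lambda>z. accepts L (f z) (g z))"
proof (rule pt_comp[where f = "\<lambda>z. (f z, g z)" and g = "\<lambda>z. accepts L (fst z) (snd z)", simplified])
  let ?E = "{z. \<exists>I. ui_ci_instance L I \<and> fst z = input I}"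
  show "pt ?E (\<lambda>z. accepts L (fst z) (snd z))"
    unfolding accepts_def split_def
    by (intro pt_conj pt_Ball pt_comp[OF pt_sat[OF assms(1)]] pt_plan_ok pt_candidate pt_Pair
        pt_fst pt_snd pt_id) (auto simp: input_def intro!: plan_ok_mem_queries)
qed (use assms in \<open>auto intro: pt_Pair\<close>)

text \<open>Soundness rests on verification alone, so \<open>v\<close> is arbitrary: it need not
  describe any plan.\<close>

lemma accepts_imp_valid_plan:
  assumes I: "ui_ci_instance L I" and acc: "accepts L (input I) v"
  shows "\<exists>\<pi>. valid_plan (workflow_of L I) \<pi>"
proof -
  let ?\<rho> = "candidate (num_steps I) (num_users I) (auth_lists (num_steps I) (num_users I) (auths I))
    (rel_lists (num_users I) (user_equiv I)) v"
  let ?\<pi> = "restrict (nth ?\<rho>) {..<num_steps I}"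
  have ok: "plan_ok (num_steps I) (num_users I) (auth_lists (num_steps I) (num_users I) (auths I)) ?\<rho>"
    and sat: "\<And>d. d \<in> set (descriptions I) \<Longrightarrow> sat L
      (num_steps I, num_users I, rel_lists (num_users I) (user_equiv I), d, ?\<rho>, ())"
    using acc unfolding accepts_def input_def by auto
  note \<pi> = plan_okD[OF length_candidate ok]
  have "satisfies ?\<pi> (constraint_of L I d)" if "d \<in> set (descriptions I)" for d
    using sat_query[OF plan_ok_valid_query[OF I that length_candidate ok]] sat[OF that] \<pi>(3)[of d] by simp
  then have "eligible (workflow_of L I) ?\<pi>" unfolding eligible_def workflow_of_def by auto
  then show ?thesis using \<pi>(1,2) unfolding valid_plan_def by blast
qed

text \<open>The vector describing \<open>\<pi>\<close> yields an authorized candidate with both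
  kernels of \<open>\<pi>\<close>, and eligibility transfers along equal kernels.\<close>

lemma valid_plan_imp_accepts:
  assumes I: "ui_ci_instance L I" and valid: "valid_plan (workflow_of L I) \<pi>"
  shows "\<exists>v. length v = num_steps I \<and> set v \<subseteq> {..<2 * num_steps I} \<and> accepts L (input I) v"
proof -
  let ?k = "num_steps I" and ?n = "num_users I" and ?W = "workflow_of L I"
  let ?A = "auth_lists ?k ?n (auths I)" and ?R = "rel_lists ?n (user_equiv I)"
  note inst = ui_ci_instanceD[OF I]
  have \<pi>: "\<pi> s < ?n" "s \<in> auths I (\<pi> s)" if "s < ?k" for s
    using valid that unfolding valid_plan_def plans_def authorized_def workflow_of_def by auto
  obtain v where v: "length v = ?k" "set v \<subseteq> {..<2 * ?k}"
    and ok: "\<And>s. s < ?k \<Longrightarrow> candidate ?k ?n ?A ?R v ! s < ?n \<and> s \<in> auths I (candidate ?k ?n ?A ?R v ! s)"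
    and eq: "\<And>s t. s < ?k \<Longrightarrow> t < ?k \<Longrightarrow>
      candidate ?k ?n ?A ?R v ! s = candidate ?k ?n ?A ?R v ! t \<longleftrightarrow> \<pi> s = \<pi> t"
    and rel: "\<And>s t. s < ?k \<Longrightarrow> t < ?k \<Longrightarrow>
      (candidate ?k ?n ?A ?R v ! s, candidate ?k ?n ?A ?R v ! t) \<in> user_equiv I \<longleftrightarrow> (\<pi> s, \<pi> t) \<in> user_equiv I"
    using ex_candidate[OF inst(1), of ?k \<pi> "auths I"] \<pi> unfolding Let_def by blast
  let ?\<rho> = "candidate ?k ?n ?A ?R v"
  let ?\<pi> = "restrict (nth ?\<rho>) {..<?k}"
  have plan_ok: "plan_ok ?k ?n ?A ?\<rho>"
    unfolding plan_ok_def using ok by (auto simp: nth_default_nth set_auth_lists)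
  note \<rho> = plan_okD[OF length_candidate plan_ok]
  have "eligible ?W ?\<pi>"
  proof (rule eligible_same_kernels)
    show "wf_workflow ?W" by (rule inst(2))
    show "equiv (users ?W) (user_equiv I)" using inst(1) by (simp add: workflow_of_def)
    show "user_independent (users ?W) c \<or> class_independent (users ?W) (user_equiv I) c"
      if "c \<in> constraints ?W" for c
      using inst(3)[OF that] by (simp add: workflow_of_def)
    show "eligible ?W \<pi>" using valid unfolding valid_plan_def by blast
  qed (use ok eq rel \<pi> in \<open>auto simp: workflow_of_def\<close>)
  then have "satisfies ?\<pi> (constraint_of L I d)" if "d \<in> set (descriptions I)" for d
    using that unfolding eligible_def workflow_of_def by auto
  then have "sat L (?k, ?n, ?R, d, ?\<rho>, ())" if "d \<in> set (descriptions I)" for d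
    using that sat_query[OF plan_ok_valid_query[OF I that length_candidate plan_ok]] \<rho>(3)[of d] by simp
  then have "accepts L (input I) v" using plan_ok unfolding accepts_def input_def by simp
  then show ?thesis using v by blast
qed

section \<open>The main loop\<close>

definition search_step :: "constraint_language \<Rightarrow> search_state \<Rightarrow> search_state" where
  "search_step L z = (case z of (x, v, carry, found) \<Rightarrow>
     (x, snd (increment (fst x + fst x) v), fst (increment (fst x + fst x) v), accepts L x v))"

text \<open>A step tests the vector and advances it at once, so after \<open>i\<close> passes the
  flag reports on index i - 1, and \<open>i \<noteq> 0\<close> excludes the initial state. The
  initial carry is right because (2k)^k is never 0.\<close>

lemma search_step_iterate:
  assumes "i \<le> (2 * num_steps I) ^ num_steps I"
  shows "(search_step L ^^ i) (input I, digits (2 * num_steps I) (num_steps I) 0, False, False) =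
    (input I, digits (2 * num_steps I) (num_steps I) i, i = (2 * num_steps I) ^ num_steps I,
     i \<noteq> 0 \<and> accepts L (input I) (digits (2 * num_steps I) (num_steps I) (i - 1)))"
  using assms
proof (induction i)
  case (Suc i)
  have k: "fst (input I) + fst (input I) = 2 * num_steps I" by (simp add: input_def)
  show ?case using Suc increment_digits[of i "2 * num_steps I" "num_steps I"]
    by (simp add: search_step_def k)
qed auto

lemma pt_search_step:
  assumes L: "poly_time_checkable L"
  shows "pt {z. \<exists>I. ui_ci_instance L I \<and> fst z = input I} (search_step L)"
proof -
  have "pt {z. \<exists>I. ui_ci_instance L I \<and> fst z = input I}
    (\<lambda>z. (fst z, snd (increment (fst (fst z) + fst (fst z)) (fst (snd z))),
       fst (increment (fst (fst z) + fst (fst z)) (fst (snd z))), accepts L (fst z) (fst (snd z))))"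
    by (intro pt_Pair pt_increment pt_plus pt_accepts[OF L] pt_fst pt_snd pt_id) auto
  then show ?thesis by (rule pt_cong) (simp add: search_step_def split_def)
qed

theorem theorem1:
  fixes L :: constraint_language
  assumes "poly_time_checkable L"
  shows "ui_ci_wsp_solvable_in_O_star L (\<lambda>k. 2 powr (real k * log 2 (3 * real k)))"
proof -
  let ?D = "{z :: search_state. \<exists>I. ui_ci_instance L I \<and> fst z = input I}"
  let ?go = "\<lambda>z :: search_state. \<not> fst (snd (snd z)) \<and> \<not> snd (snd (snd z))"
  let ?init = "\<lambda>x :: wsp_input. (x, map (\<lambda>_. 0 :: nat) [0..<fst x], False, False)"
  have go: "pt ?D ?go" by (intro pt_conj pt_not pt_fst pt_snd pt_id)
  have step: "pt {z \<in> ?D. encode (?go z) \<noteq> Leaf} (search_step L)"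
    by (rule pt_subset[OF pt_search_step[OF assms]]) auto
  obtain P d where P: "\<forall>x N S.
      (\<forall>i\<le>N. (search_step L ^^ i) x \<in> ?D \<and> esize ((search_step L ^^ i) x) \<le> S) \<longrightarrow>
      (\<forall>i<N. encode (?go ((search_step L ^^ i) x)) \<noteq> Leaf) \<longrightarrow>
      encode (?go ((search_step L ^^ N) x)) = Leaf \<longrightarrow>
      computes_in P (encode x) (Suc N * (S + 2) ^ d) (encode ((search_step L ^^ N) x))"
    using pt_while[OF go step] by blast
  have "pt UNIV ?init" by (intro pt_intros)
  obtain Q T where Q: "pbound UNIV T"
    "\<And>x. x \<in> UNIV \<Longrightarrow> computes_in Q (encode x) (T x) (encode (?init x))"
    using ptE[OF \<open>pt UNIV ?init\<close>] by blast
  \<comment> \<open>Three tails lead past the input, the vector and the carry to the flag that is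
    the answer.\<close>
  let ?F = "Assign 0 (Tl (Tl (Tl (Var 0))))"
  \<comment> \<open>The product bounds a vector of at most \<open>esize x\<close> digits of size at
    most 2 * \<open>esize x\<close>; the 10 leaves room for the flags and the pairing nodes.\<close>
  let ?S = "\<lambda>x :: wsp_input. esize x + esize x * Suc (2 * esize x) + 10"
  let ?h = "\<lambda>x. 2 * (T x + (?S x + 2) ^ d + (3 * com_bound P + 3) + (5 + (3 * com_bound ?F + 3)))"
  have "pbound UNIV ?h" by (intro pbound_intros Q(1))
  then obtain e where e: "\<And>x. ?h x \<le> (esize x + 2) ^ e" unfolding pbound_def by blast
  \<comment> \<open>\<open>[:2, 1:]\<close> is the polynomial X + 2, the base of the powers in
    \<open>pbound\<close>.\<close>
  have "decides_within (Seq (Seq Q (call 0 P)) (call 0 ?F)) (enc_instance I)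
      (\<exists>\<pi>. valid_plan (workflow_of L I) \<pi>)
      (real (poly ([:2, 1:] ^ e) (size (enc_instance I))) *
        2 powr (real (num_steps I) * log 2 (3 * real (num_steps I))))"
    if I: "ui_ci_instance L I" for I
  proof -
    let ?k = "num_steps I" and ?x = "input I"
    let ?G = "(2 * ?k) ^ ?k" and ?v = "digits (2 * ?k) ?k"
    let ?z = "\<lambda>i. (search_step L ^^ i) (?x, ?v 0, False, False)"
    have z: "?z i = (?x, ?v i, i = ?G, i \<noteq> 0 \<and> accepts L ?x (?v (i - 1)))" if "i \<le> ?G" for i
      using search_step_iterate[OF that] .
    let ?halt = "\<lambda>i. i = ?G \<or> i \<noteq> 0 \<and> accepts L ?x (?v (i - 1))"
    \<comment> \<open>The number of passes: the loop ends when the counter wraps around or the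
      vector just tested is accepted.\<close>
    define N where "N = (LEAST i. ?halt i)"
    have N: "?halt N" unfolding N_def by (rule LeastI[of _ ?G]) simp
    have least: "\<not> ?halt i" if "i < N" for i using not_less_Least that unfolding N_def by blast
    have NG: "N \<le> ?G" unfolding N_def by (rule Least_le) simp
    define found where "found \<longleftrightarrow> N \<noteq> 0 \<and> accepts L ?x (?v (N - 1))"
    have G: "?G \<noteq> 0" by (cases ?k) auto
    have found: "found \<longleftrightarrow> (\<exists>\<pi>. valid_plan (workflow_of L I) \<pi>)"
    proof
      assume "\<exists>\<pi>. valid_plan (workflow_of L I) \<pi>"
      then obtain v where v: "length v = ?k" "set v \<subseteq> {..<2 * ?k}" "accepts L ?x v"
        using valid_plan_imp_accepts[OF I] by blast
      then obtain i where i: "i < ?G" "?v i = v" using ex_digits[OF v(2)] by auto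
      then have "?halt (Suc i)" using v(3) by simp
      then have "N \<le> Suc i" unfolding N_def by (rule Least_le)
      show found
      proof (cases "N = Suc i")
        case True
        then show ?thesis using i(2) v(3) unfolding found_def by simp
      next
        \<comment> \<open>Here the loop stops earlier, before the counter wraps around, so some
          other vector has been accepted.\<close>
        case False
        then have "N \<noteq> ?G" using \<open>N \<le> Suc i\<close> i(1) by simp
        then show ?thesis using N unfolding found_def by blast
      qed
    qed (use accepts_imp_valid_plan[OF I] in \<open>auto simp: found_def\<close>)
    have "esize (?z i) \<le> ?S ?x" if "i \<le> ?G" for i
    proof -
      have k: "?k \<le> esize ?x" by (simp add: input_def)
      have "esize (?v i) \<le> esize ?x * Suc (2 * esize ?x)"
      proof (rule esize_list_le)
        show "esize y \<le> 2 * esize ?x" if "y \<in> set (?v i)" for y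
          using digits_less[OF _ that] that k by (cases "?k = 0") auto
      qed (use k in simp)
      then show ?thesis unfolding z[OF that] by (auto simp: encode_bool_def)
    qed
    moreover have "?z i \<in> ?D" if "i \<le> ?G" for i unfolding z[OF that] using I by auto
    moreover have "encode (?go (?z i)) \<noteq> Leaf" if "i < N" for i
      using z[of i] least[OF that] that NG by simp
    moreover have "encode (?go (?z N)) = Leaf" using z[OF NG] N by auto
    ultimately have run: "computes_in P (encode (?x, ?v 0, False, False)) (Suc N * (?S ?x + 2) ^ d) (encode (?z N))"
      using NG by (intro P[rule_format]) auto
    have "?init ?x = (?x, ?v 0, False, False)"
      by (simp add: digits_0 input_def map_replicate_const)
    with computes_in_comp[OF Q(2)[OF UNIV_I, of ?x]] run have 1: "computes_in (Seq Q (call 0 P)) (encode ?x)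
      (T ?x + Suc N * (?S ?x + 2) ^ d + (3 * com_bound P + 3)) (encode (?z N))" by auto
    have "computes_in ?F (encode (?z N)) 5 (encode found)"
      using computes_in_mono[OF computes_in_expr[of "Tl (Tl (Tl (Var 0)))" "encode (?z N)"], of 5]
      unfolding z[OF NG] found_def by simp
    from computes_in_comp[OF 1 this] have 2: "computes_in (Seq (Seq Q (call 0 P)) (call 0 ?F)) (encode ?x)
      (T ?x + Suc N * (?S ?x + 2) ^ d + (3 * com_bound P + 3) + 5 + (3 * com_bound ?F + 3)) (encode found)" .
    have "T ?x + Suc N * (?S ?x + 2) ^ d + (3 * com_bound P + 3) + 5 + (3 * com_bound ?F + 3) \<le>
        Suc N * (T ?x + (?S ?x + 2) ^ d + (3 * com_bound P + 3) + (5 + (3 * com_bound ?F + 3)))"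
      by (simp add: algebra_simps)
    \<comment> \<open>\<open>Suc N\<close> is at most twice \<open>?G\<close> because
      \<open>?G\<close> is positive; the factor 2 is the one built into \<open>?h\<close>.\<close>
    also have "\<dots> \<le> (2 * ?G) * (T ?x + (?S ?x + 2) ^ d + (3 * com_bound P + 3) + (5 + (3 * com_bound ?F + 3)))"
      using NG G by (intro mult_le_mono1) linarith
    also have "\<dots> = ?h ?x * ?G" by (simp only: ac_simps)
    also have "\<dots> \<le> (esize ?x + 2) ^ e * ?G" using e by (rule mult_le_mono1)
    finally have "computes_in (Seq (Seq Q (call 0 P)) (call 0 ?F)) (encode ?x) ((esize ?x + 2) ^ e * ?G)
      (encode found)" by (rule computes_in_mono[OF 2])
    then obtain t s where ts: "exec (Seq (Seq Q (call 0 P)) (call 0 ?F)) ((\<lambda>_. Leaf)(0 := enc_instance I)) t s"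
      "t \<le> (esize ?x + 2) ^ e * ?G" "s 0 = encode found"
      unfolding computes_in_def encode_input by blast
    \<comment> \<open>The logarithm requires a positive argument, so k = 0 is separate: both sides
      are then 1. Otherwise the right-hand side equals (3k)^k, and 2k \<le> 3k.\<close>
    have "real ?G \<le> 2 powr (real ?k * log 2 (3 * real ?k))"
    proof (cases "?k = 0")
      case False
      have "2 powr (real ?k * log 2 (3 * real ?k)) = (3 * real ?k) powr real ?k"
        using False by (simp add: mult.commute[of "real ?k"] powr_powr[symmetric])
      also have "\<dots> = (3 * real ?k) ^ ?k" using False by (simp add: powr_realpow)
      also have "\<dots> \<ge> (2 * real ?k) ^ ?k" by (rule power_mono) auto
      finally show ?thesis by simp
    qed simp
    then have A: "real ((esize ?x + 2) ^ e) * real ?G \<le>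
        real ((esize ?x + 2) ^ e) * 2 powr (real ?k * log 2 (3 * real ?k))"
      by (intro mult_left_mono) auto
    have p: "poly ([:2, 1:] ^ e) (size (enc_instance I)) = (esize ?x + 2) ^ e"
      by (simp add: poly_power encode_input add.commute)
    have "real t \<le> real ((esize ?x + 2) ^ e) * real ?G" using ts(2) by (metis of_nat_le_iff of_nat_mult)
    from order_trans[OF this A] have "real t \<le> real (poly ([:2, 1:] ^ e) (size (enc_instance I))) *
        2 powr (real ?k * log 2 (3 * real ?k))" unfolding p .
    moreover have "s 0 \<noteq> Leaf \<longleftrightarrow> (\<exists>\<pi>. valid_plan (workflow_of L I) \<pi>)"
      using ts(3) found by (cases found) auto
    ultimately show ?thesis unfolding decides_within_def using ts(1) by blast
  qed
  then show ?thesis unfolding ui_ci_wsp_solvable_in_O_star_def by blast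
qed

end
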